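(* Let $r\geq 2$ be an integer, let $0<b<2^{-10}r^{-6}$, let $n\geq r^{20}$, and let $G$ be a graph of order $n$. If $\mu(G)>(1-1/r-b)n$, then $G$ satisfies at least one of the following: (a) $js_{r+1}(G)>n^{r-1}/r^{2r+5}$; (b) $G$ contains an induced subgraph $G_0$ which is $r$-partite, has at least $(1-4b^{1/3})n$ vertices, and has minimum degree $\delta(G_0)>(1-1/r-7b^{1/3})n$.
   Context: All graphs are finite and simple. For a graph $G$, $\mu(G)$ denotes the largest eigenvalue of the adjacency matrix of $G$, and $\delta(G)$ its minimum degree. A graph is $r$-partite if its vertex set can be partitioned into $r$ independent sets. For an integer $k\ge 2$, a $k$-joint of size $t$ is the union of $t$ distinct $k$-cliques all sharing a common edge; $js_k(G)$ denotes the maximum size of a $k$-joint contained in $G$. *)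

theory Defs
  imports
    "HOL-Analysis.Analysis"
    "Jordan_Normal_Form.Spectral_Radius"
    "Graph_Theory.Graph_Theory"
begin

text \<open>
  A finite simple graph is a record satisfying the predicate \<^const>\<open>graph\<close>: a finite, loop-free,
  symmetric digraph without parallel arcs. An undirected edge is a pair of opposite arcs, so the
  degree of a vertex is its \<^const>\<open>out_degree\<close>.
\<close>

text \<open>
  A different enumeration of the vertices conjugates the matrix by a permutation matrix and
  leaves its spectrum unchanged.
\<close>

definition adjacency_matrix :: "('a, 'b) pre_digraph \<Rightarrow> real mat" where
  "adjacency_matrix G =
     (let vs = (SOME vs. distinct vs \<and> set vs = verts G)
      in mat (length vs) (length vs)
           (\<lambda>(i, j). if (vs ! i, vs ! j) \<in> arcs_ends G then 1 else 0))"

definition graph_index :: "('a, 'b) pre_digraph \<Rightarrow> real" where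
  "graph_index G = Max (spectrum (adjacency_matrix G))"

definition min_degree :: "('a, 'b) pre_digraph \<Rightarrow> nat" where
  "min_degree G = Min (out_degree G ` verts G)"

definition independent_in :: "('a, 'b) pre_digraph \<Rightarrow> 'a set \<Rightarrow> bool" where
  "independent_in G S \<longleftrightarrow> S \<subseteq> verts G \<and> (\<forall>u\<in>S. \<forall>v\<in>S. (u, v) \<notin> arcs_ends G)"

text \<open>Parts are allowed to be empty.\<close>

definition multipartite :: "nat \<Rightarrow> ('a, 'b) pre_digraph \<Rightarrow> bool" where
  "multipartite r G \<longleftrightarrow>
     (\<exists>P :: nat \<Rightarrow> 'a set. disjoint_family_on P {..<r} \<and> (\<Union>i<r. P i) = verts G \<and>
        (\<forall>i<r. independent_in G (P i)))"

text \<open>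
  The cliques in \<open>C\<close> are subgraphs of \<open>J\<close>, hence they share its \<^const>\<open>tail\<close> and \<^const>\<open>head\<close>
  maps and are distinct records iff they are distinct as subgraphs. The empty graph is the only
  joint of size 0.
\<close>

definition is_joint :: "nat \<Rightarrow> nat \<Rightarrow> ('a, 'b) pre_digraph \<Rightarrow> bool" where
  "is_joint k t J \<longleftrightarrow> graph J \<and>
     (\<exists>C. finite C \<and> card C = t \<and>
        (\<forall>H\<in>C. subgraph H J \<and> complete_digraph k H) \<and>
        (\<exists>e. \<forall>H\<in>C. e \<in> arcs H) \<and>
        verts J = (\<Union>H\<in>C. verts H) \<and> arcs J = (\<Union>H\<in>C. arcs H))"

definition joint_size :: "nat \<Rightarrow> ('a, 'b) pre_digraph \<Rightarrow> nat" where
  "joint_size k G = Max {t. \<exists>J. subgraph J G \<and> is_joint k t J}"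

end

theory Submission
  imports Defs
begin

text \<open>
  Write \<open>a = 1 - 1/r\<close> and suppose that every edge lies in at most \<open>n\<^sup>r\<^sup>-\<^sup>1 / r\<^sup>2\<^sup>r\<^sup>+\<^sup>5\<close> cliques of
  order \<open>r + 1\<close>. A weighted Moon--Moser inequality bounds \<open>\<Sum>\<^sub>u\<^sub>\<sim>\<^sub>v y u y v\<close> for probability
  weights \<open>y\<close>; applied to the uniform weights and to the squared entries of a Perron vector it
  shows, by Cauchy--Schwarz, that \<open>\<mu> / m\<close> cannot exceed \<open>a\<close> by a constant on any induced subgraph of order
  \<open>m \<ge> n / 2\<close>. As long as some degree is at most \<open>(a - 1 / (2 r\<^sup>4)) m\<close>, deleting the vertex with the
  smallest Perron entry increases \<open>\<mu> / m\<close> by at least a constant times \<open>1 / n\<close>. Hence the deletion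
  stops early, at a subgraph \<open>H\<close> of large minimum degree.

  In a graph of large minimum degree, an \<open>(r + 1)\<close>-clique contains an edge whose codegree exceeds
  \<open>(1 - 2/r) m\<close> by a constant fraction of \<open>m\<close>, and this edge lies in too many \<open>(r + 1)\<close>-cliques.
  So \<open>H\<close> has no such clique, which bounds the number of deleted vertices in terms of \<open>b\<close> and, by the
  theorem of Andrasfai, Erdos and Sos, makes \<open>H\<close> \<open>r\<close>-partite. As \<open>\<mu>\<^sup>2 \<le> 2 e(H) a\<close>, only \<open>O(b m\<^sup>2)\<close>
  pairs between the parts are missing, so few vertices of \<open>H\<close> have small degree, and removing them
  gives \<open>G\<^sub>0\<close>.
\<close>

section \<open>Auxiliary inequalities\<close>

lemma fact_mult_power_le_prod:
  fixes f :: "nat \<Rightarrow> real"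
  assumes "0 \<le> h" "\<And>i. i < q \<Longrightarrow> (real q - real i) * h \<le> f i"
  shows "fact q * h ^ q \<le> (\<Prod>i<q. f i)"
proof -
  have "fact q * h ^ q = (\<Prod>i<q. (real q - real i) * h)"
    by (simp add: fact_prod_rev prod.distrib atLeast0LessThan of_nat_diff)
  also have "\<dots> \<le> (\<Prod>i<q. f i)" by (rule prod_mono) (use assms in auto)
  finally show ?thesis .
qed

text \<open>Up to the factor \<open>card W\<close>, the right-hand side is the codegree bound of
  \<open>ex_edge_large_codegree\<close> less \<open>s\<close> times the bound on the number of non-neighbours.\<close>

lemma codegree_excess:
  fixes r s :: real
  assumes r: "r \<ge> 2" and s: "s \<le> r - 2"
  defines "e \<equiv> 1 / (2 * r ^ 4)"
  shows "(r - 2 - s) / r + 5 / (6 * r ^ 3)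
    \<le> 2 * (r - 1) / r * (1 - 1 / r - e) - (r - 1) / (r + 1) - s * (1 / r + e)"
proof -
  have "2 * (r - 1) / r \<le> 2" using r by (simp add: field_simps)
  then have "(2 * (r - 1) / r + s) * e \<le> r * e"
    using s by (intro mult_right_mono) (auto simp: e_def)
  also have "\<dots> = 1 / (2 * r ^ 3)" using r by (simp add: e_def field_simps eval_nat_numeral)
  finally have "(2 * (r - 1) / r + s) * e \<le> 1 / (2 * r ^ 3)" .
  moreover have "4 / (3 * r ^ 3) \<le> 2 / (r\<^sup>2 * (r + 1))"
    using r by (simp add: divide_simps power2_eq_square power3_eq_cube)
  moreover have "5 / (6 * r ^ 3) = 4 / (3 * r ^ 3) - 1 / (2 * r ^ 3)"
    using r by (simp add: divide_simps)
  moreover have "2 * (r - 1) / r * (1 - 1 / r - e) - (r - 1) / (r + 1) - s * (1 / r + e)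
      = (r - 2 - s) / r + 2 / (r\<^sup>2 * (r + 1)) - (2 * (r - 1) / r + s) * e"
    using r by (simp add: divide_simps power2_eq_square) (simp add: algebra_simps)
  ultimately show ?thesis by linarith
qed

lemma linear_le_square_imp_zero:
  fixes c l :: real
  assumes "\<And>t. t * c \<le> l * t\<^sup>2"
  shows "c = 0"
proof (rule ccontr)
  assume "c \<noteq> 0"
  define k where "k = \<bar>l\<bar> + 1"
  have k: "k > 0" "l < k" by (auto simp: k_def)
  have "(c / k) * c \<le> l * (c / k)\<^sup>2" by (rule assms)
  then have "c\<^sup>2 * k \<le> c\<^sup>2 * l" using k by (simp add: field_simps power2_eq_square)
  then show False using k \<open>c \<noteq> 0\<close> by (simp add: mult_le_cancel_left_pos)
qed

text \<open>Applied to \<open>F = \<mu> / m\<close> and \<open>y = m X\<close>, where \<open>X\<close> is the least squared entry of a Perron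
  vector.\<close>

lemma scaled_min_entry_le:
  fixes a b e F y :: real
  assumes e: "0 < e" "e \<le> 1 / 32" and b: "0 \<le> b" "b \<le> e / 20" and a: "1 / 2 \<le> a"
    and F: "a - b \<le> F" and y: "0 \<le> y" "y * (F\<^sup>2 + (a - e) * (1 - (a - e))) \<le> a - e"
  shows "y \<le> 1 - 7 / 4 * e"
proof (rule ccontr)
  have pos: "0 < a - e" "0 < a - b" using a b e by auto
  have "2 * a * b \<le> 2 * a * (e / 20)" using a b by (intro mult_left_mono) auto
  moreover have "(a - b)\<^sup>2 =
      (a - e) * (a + 9 / 10 * e) + (2 * a * (e / 20) - 2 * a * b) + (b\<^sup>2 + 9 / 10 * e\<^sup>2)"
    by (simp add: field_simps power2_eq_square)
  moreover have "0 \<le> b\<^sup>2 + 9 / 10 * e\<^sup>2" by simp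
  ultimately have "(a - e) * (a + 9 / 10 * e) \<le> (a - b)\<^sup>2" by linarith
  also have "\<dots> \<le> F\<^sup>2" using F pos by (intro power_mono) auto
  finally have "(a - e) * (1 + 19 / 10 * e) \<le> F\<^sup>2 + (a - e) * (1 - (a - e))"
    by (simp add: field_simps)
  then have "y * ((a - e) * (1 + 19 / 10 * e)) \<le> y * (F\<^sup>2 + (a - e) * (1 - (a - e)))"
    using y(1) by (intro mult_left_mono)
  then have "(a - e) * (y * (1 + 19 / 10 * e)) \<le> (a - e) * 1" using y(2) by (simp add: mult_ac)
  then have "y * (1 + 19 / 10 * e) \<le> 1" using pos by (simp only: mult_le_cancel_left_pos)
  moreover assume "\<not> y \<le> 1 - 7 / 4 * e"
  then have "(1 - 7 / 4 * e) * (1 + 19 / 10 * e) < y * (1 + 19 / 10 * e)"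
    using e by (intro mult_strict_right_mono) auto
  ultimately have "(1 - 7 / 4 * e) * (1 + 19 / 10 * e) < 1" by linarith
  moreover have "e * e \<le> e * (1 / 32)" using e by (intro mult_left_mono) auto
  ultimately show False using e by (simp add: algebra_simps)
qed

lemma deletion_ratio_ge:
  fixes c l l' m X :: real
  assumes m: "1 < m" and l: "0 \<le> l" and c: "0 \<le> c" and X: "0 \<le> X"
    and gap: "m * X \<le> m * (1 - m * X - c)" and deletion: "l * (1 - 2 * X) \<le> l' * (1 - X)"
  shows "l / m * (1 + c / m) \<le> l' / (m - 1)"
proof -
  have "X \<le> 1 - m * X - c" using gap m by simp
  moreover have "1 * X \<le> m * X" using m X by (intro mult_right_mono) auto
  ultimately have X1: "X < 1" using c by linarith
  have "0 \<le> c * (1 + X * (m - 1))" using c X m by (intro mult_nonneg_nonneg add_nonneg_nonneg) auto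
  then have "(m + c) * (m - 1) * (1 - X) \<le> m\<^sup>2 * (1 - 2 * X)"
    using gap by (simp add: algebra_simps power2_eq_square)
  then have "l * ((m + c) * (m - 1) * (1 - X)) \<le> l * (m\<^sup>2 * (1 - 2 * X))"
    using l by (rule mult_left_mono)
  also have "\<dots> \<le> m\<^sup>2 * (l' * (1 - X))"
    using mult_left_mono[OF deletion, of "m\<^sup>2"] by (simp add: mult_ac)
  finally have "(l * ((m + c) * (m - 1))) * (1 - X) \<le> (m\<^sup>2 * l') * (1 - X)" by (simp add: mult_ac)
  then have "l * ((m + c) * (m - 1)) \<le> m\<^sup>2 * l'" using X1 by simp
  then show ?thesis using m by (simp add: field_simps power2_eq_square)
qed

lemma sum_card_colour_classes:
  fixes c :: "'a \<Rightarrow> nat"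
  assumes W: "finite W" and c: "c ` W \<subseteq> {..<r}" and r: "r > 0"
  defines "p i \<equiv> real (card {v \<in> W. c v = i})"
  shows "(\<Sum>u\<in>W. p (c u)) = (real (card W))\<^sup>2 / real r + (\<Sum>i<r. (p i - real (card W) / real r)\<^sup>2)"
proof -
  let ?m = "real (card W)"
  have total: "(\<Sum>i<r. p i) = ?m"
    using sum.group[OF W _ c, of "\<lambda>_. 1 :: real"] by (simp add: p_def)
  have "(\<Sum>u\<in>W. p (c u)) = (\<Sum>i<r. \<Sum>u | u \<in> W \<and> c u = i. p (c u))"
    by (rule sum.group[OF W _ c, symmetric]) simp
  also have "\<dots> = (\<Sum>i<r. (p i)\<^sup>2)"
    by (intro sum.cong refl) (simp add: p_def power2_eq_square)
  finally have squares: "(\<Sum>u\<in>W. p (c u)) = (\<Sum>i<r. (p i)\<^sup>2)" .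
  have "(\<Sum>i<r. (p i - ?m / real r)\<^sup>2) = (\<Sum>i<r. (p i)\<^sup>2 - 2 * (?m / real r) * p i + (?m / real r)\<^sup>2)"
    by (intro sum.cong refl) (simp add: power2_diff)
  also have "\<dots> = (\<Sum>i<r. (p i)\<^sup>2) - 2 * (?m / real r) * (\<Sum>i<r. p i) + real r * (?m / real r)\<^sup>2"
    by (simp add: sum.distrib sum_subtractf sum_distrib_left)
  also have "\<dots> = (\<Sum>i<r. (p i)\<^sup>2) - ?m\<^sup>2 / real r"
    unfolding total using r by (simp add: power2_eq_square field_simps)
  finally show ?thesis using squares by simp
qed

lemma four_mult_eight_power_le:
  fixes r :: nat
  assumes "r \<ge> 2"
  shows "4 * 8 ^ (r - 1) \<le> r ^ (r + 3)"
proof (cases "r < 8")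
  case True
  then have "r \<in> {2, 3, 4, 5, 6, 7}" using assms by auto
  then show ?thesis by auto
next
  case False
  have "4 * 8 ^ (r - 1) \<le> (8 :: nat) ^ 4 * 8 ^ (r - 1)" by simp
  also have "\<dots> = 8 ^ (4 + (r - 1))" by (simp only: power_add)
  also have "4 + (r - 1) = r + 3" using assms by simp
  also have "8 ^ (r + 3) \<le> r ^ (r + 3)" using False by (intro power_mono) auto
  finally show ?thesis .
qed

text \<open>If every edge of a graph of order \<open>n\<close> lies in at most \<open>n\<^sup>r\<^sup>-\<^sup>1 / r\<^sup>2\<^sup>r\<^sup>+\<^sup>5\<close> cliques of order
  \<open>r + 1\<close>, then on a subset of order \<open>m \<ge> n / 2\<close> this number is at most \<open>\<gamma> m\<^sup>r\<^sup>-\<^sup>1\<close>.\<close>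

lemma
  fixes r :: nat
  assumes r: "r \<ge> 2"
  defines "\<gamma> \<equiv> 2 ^ (r - 1) / real r ^ (2 * r + 5)"
  shows spectral_excess_le: "(1 + 4 ^ (r - 1)) / 2 * \<gamma> * real r ^ (r - 2) \<le>
      5 / 16 * (1 / (2 * real r ^ 4))"
    and clique_density_less: "\<gamma> < 5 / (6 * real r ^ (r + 2))"
proof -
  have r0: "real r \<ge> 2" using r by simp
  have "real (4 * 8 ^ (r - 1)) \<le> real (r ^ (r + 3))"
    using four_mult_eight_power_le[OF r] by (rule of_nat_mono)
  then have eight: "4 * 8 ^ (r - 1) \<le> real r ^ (r + 3)" by simp
  have "(4::real) ^ 1 \<le> 4 ^ (r - 1)" using r by (intro power_increasing) auto
  then have "2 ^ (r - 1) * 4 \<le> 2 ^ (r - 1) * (4 ^ (r - 1) :: real)" by (intro mult_left_mono) auto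
  also have "\<dots> = 8 ^ (r - 1)" by (simp flip: power_mult_distrib)
  finally have two: "16 * 2 ^ (r - 1) \<le> real r ^ (r + 3)" using eight by simp
  have "(1 + 4 ^ (r - 1)) * 2 ^ (r - 1) = 2 ^ (r - 1) + (8 ^ (r - 1) :: real)"
    by (simp add: distrib_right flip: power_mult_distrib)
  also have "\<dots> \<le> 5 / 16 * real r ^ (r + 3)" using two eight by simp
  finally have sum: "(1 + 4 ^ (r - 1)) * 2 ^ (r - 1) \<le> 5 / 16 * real r ^ (r + 3)" .
  have "2 * r + 5 = (r - 2) + (r + 3) + 4" using r by simp
  then have split: "real r ^ (2 * r + 5) = real r ^ (r - 2) * real r ^ (r + 3) * real r ^ 4"
    by (simp only: power_add)
  have "(1 + 4 ^ (r - 1)) / 2 * \<gamma> * real r ^ (r - 2) =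
      (1 + 4 ^ (r - 1)) * 2 ^ (r - 1) / (2 * real r ^ (r + 3) * real r ^ 4)"
    unfolding \<gamma>_def split using r0 by simp
  also have "\<dots> \<le> 5 / 16 * real r ^ (r + 3) / (2 * real r ^ (r + 3) * real r ^ 4)"
    using sum by (intro divide_right_mono) auto
  finally show "(1 + 4 ^ (r - 1)) / 2 * \<gamma> * real r ^ (r - 2) \<le> 5 / 16 * (1 / (2 * real r ^ 4))"
    using r0 by simp
  have "2 ^ (r - 1) * 6 \<le> 2 / 5 * 16 * (2 ^ (r - 1) :: real)" by simp
  also have "\<dots> \<le> 2 / 5 * real r ^ (r + 3)" using two by linarith
  also have "\<dots> < 5 * real r ^ (r + 3)" using r0 by simp
  finally have "2 ^ (r - 1) * (6 * real r ^ (r + 2)) < 5 * real r ^ (r + 3) * real r ^ (r + 2)"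
    using r0 by (simp flip: mult.assoc)
  also have "\<dots> = 5 * real r ^ ((r + 3) + (r + 2))" by (simp only: power_add mult.assoc)
  also have "(r + 3) + (r + 2) = 2 * r + 5" by simp
  finally show "\<gamma> < 5 / (6 * real r ^ (r + 2))"
    unfolding \<gamma>_def using r0 by (simp add: field_simps)
qed

lemma cube_root_bounds:
  fixes b :: real and r :: nat
  assumes r: "r \<ge> 2" and b: "0 < b" "b < 1 / (2 ^ 10 * real r ^ 6)"
  defines "\<beta> \<equiv> b powr (1 / 3)"
  shows "0 < \<beta>" "\<beta> ^ 3 = b" "\<beta> \<le> 1 / 40" "b * real r ^ 4 \<le> \<beta> / 100"
proof -
  show pos: "0 < \<beta>" and cube: "\<beta> ^ 3 = b"
    using b by (simp_all add: \<beta>_def powr_realpow[symmetric] powr_powr)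
  have small: "\<beta> * (real r)\<^sup>2 < 1 / 10"
  proof (rule power_less_imp_less_base)
    have "(\<beta> * (real r)\<^sup>2) ^ 3 = b * real r ^ 6"
      by (simp add: power_mult_distrib cube flip: power_mult)
    also have "\<dots> < 1 / 2 ^ 10" using b r by (simp add: field_simps)
    also have "\<dots> \<le> (1 / 10) ^ 3" by (simp add: eval_nat_numeral)
    finally show "(\<beta> * (real r)\<^sup>2) ^ 3 < (1 / 10) ^ 3" .
  qed simp
  have "\<beta> * 4 \<le> \<beta> * (real r)\<^sup>2"
    using pos r power_mono[of 2 "real r" 2] by (intro mult_left_mono) auto
  then show "\<beta> \<le> 1 / 40" using small by linarith
  have "b * real r ^ 4 = \<beta> * (\<beta> * (real r)\<^sup>2)\<^sup>2"
    by (simp add: cube[symmetric] power_mult_distrib power2_eq_square power3_eq_cube power4_eq_xxxx)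
  also have "\<dots> \<le> \<beta> * (1 / 10)\<^sup>2" using small pos by (intro mult_left_mono power_mono) auto
  finally show "b * real r ^ 4 \<le> \<beta> / 100" by (simp add: power2_eq_square)
qed

section \<open>Weighted cliques\<close>

locale simple_adjacency =
  fixes E :: "'a \<Rightarrow> 'a \<Rightarrow> bool"
  assumes sym: "E u v \<Longrightarrow> E v u" and irrefl: "\<not> E u u"
begin

definition nbrs :: "'a set \<Rightarrow> 'a \<Rightarrow> 'a set" where
  "nbrs V u = {v \<in> V. E u v}"

definition non_nbrs :: "'a set \<Rightarrow> 'a \<Rightarrow> 'a set" where
  "non_nbrs V u = {v \<in> V. \<not> E u v}"

definition common_nbrs :: "'a set \<Rightarrow> 'a set \<Rightarrow> 'a set" where
  "common_nbrs V R = {w \<in> V. \<forall>u\<in>R. E u w}"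

definition degree :: "'a set \<Rightarrow> 'a \<Rightarrow> nat" where
  "degree V u = card (nbrs V u)"

definition degree_sum :: "'a set \<Rightarrow> nat" where
  "degree_sum V = (\<Sum>u\<in>V. degree V u)"

definition cliques :: "'a set \<Rightarrow> nat \<Rightarrow> 'a set set" where
  "cliques V s = {R. R \<subseteq> V \<and> card R = s \<and> pairwise E R}"

definition clique_extensions :: "'a set \<Rightarrow> nat \<Rightarrow> 'a set \<Rightarrow> 'a set set" where
  "clique_extensions V s T = {R \<in> cliques V s. T \<subseteq> R}"

definition clique_weight :: "'a set \<Rightarrow> ('a \<Rightarrow> real) \<Rightarrow> nat \<Rightarrow> real" where
  "clique_weight V y s = (\<Sum>R\<in>cliques V s. prod y R)"

definition adj_form :: "'a set \<Rightarrow> ('a \<Rightarrow> real) \<Rightarrow> real" where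
  "adj_form V x = (\<Sum>u\<in>V. \<Sum>v\<in>nbrs V u. x u * x v)"

lemma adj_commute: "E u v \<longleftrightarrow> E v u"
  using sym by blast

lemma finite_nbrs [simp]: "finite V \<Longrightarrow> finite (nbrs V u)"
  by (simp add: nbrs_def)

lemma finite_non_nbrs [simp]: "finite V \<Longrightarrow> finite (non_nbrs V u)"
  by (simp add: non_nbrs_def)

lemma finite_common_nbrs [simp]: "finite V \<Longrightarrow> finite (common_nbrs V R)"
  by (simp add: common_nbrs_def)

lemma finite_cliques [simp]: "finite V \<Longrightarrow> finite (cliques V s)"
  unfolding cliques_def by (rule finite_subset[of _ "Pow V"]) auto

lemma finite_clique_extensions [simp]: "finite V \<Longrightarrow> finite (clique_extensions V s T)"
  by (simp add: clique_extensions_def)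

lemma nbrs_subset: "nbrs V u \<subseteq> V"
  by (auto simp: nbrs_def)

lemma real_degree:
  assumes "finite V"
  shows "real (degree V u) = real (card V) - real (card (non_nbrs V u))"
  using card_Int_Diff[OF assms, of "nbrs V u"]
  by (simp add: degree_def nbrs_def non_nbrs_def Int_def set_diff_eq cong: conj_cong)

lemma card_non_nbrs_mono: "finite W \<Longrightarrow> U \<subseteq> W \<Longrightarrow> card (non_nbrs U u) \<le> card (non_nbrs W u)"
  by (intro card_mono) (auto simp: non_nbrs_def)

lemma degree_le_card: "finite V \<Longrightarrow> degree V u \<le> card V"
  by (simp add: degree_def card_mono nbrs_subset)

lemma cliquesD:
  assumes "finite V" "R \<in> cliques V s"
  shows "finite R" "R \<subseteq> V" "card R = s" "pairwise E R"
  using assms finite_subset unfolding cliques_def by auto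

lemma cliques_mono: "W \<subseteq> V \<Longrightarrow> cliques W s \<subseteq> cliques V s"
  unfolding cliques_def by auto

lemma cliques_0: "finite V \<Longrightarrow> cliques V 0 = {{}}"
  by (auto simp: cliques_def dest: finite_subset)

lemma cliques_1: "cliques V (Suc 0) = (\<lambda>v. {v}) ` V"
  by (auto simp: cliques_def card_Suc_eq)

lemma doubleton_cliques: "{u, v} \<in> cliques V 2 \<longleftrightarrow> u \<in> V \<and> v \<in> V \<and> E u v"
  using sym irrefl unfolding cliques_def by (auto simp: pairwise_insert card_insert_if)

lemma subset_cliques:
  assumes "R \<in> cliques V s" "T \<subseteq> R"
  shows "T \<in> cliques V (card T)"
  using assms unfolding cliques_def by (auto intro: pairwise_subset)

lemma union_cliques:
  assumes "finite V" "T \<in> cliques V s" "Q \<in> cliques (common_nbrs V T) k"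
  shows "T \<union> Q \<in> cliques V (s + k)" "T \<inter> Q = {}"
proof -
  note finite = cliquesD(1)[OF assms(1,2)] cliquesD(1)[OF finite_common_nbrs[OF assms(1)] assms(3)]
  show disjoint: "T \<inter> Q = {}"
    using assms(3) irrefl by (auto simp: cliques_def common_nbrs_def)
  have "pairwise E (T \<union> Q)"
    using assms(2,3) sym unfolding cliques_def common_nbrs_def pairwise_def by blast
  then show "T \<union> Q \<in> cliques V (s + k)"
    using assms(2,3) card_Un_disjoint[OF finite disjoint]
    by (auto simp: cliques_def common_nbrs_def)
qed

lemma insert_cliques:
  assumes "finite V" "T \<in> cliques V s" "w \<in> common_nbrs V T"
  shows "insert w T \<in> cliques V (Suc s)" "w \<notin> T"
  using union_cliques[OF assms(1,2), of "{w}" "Suc 0"] assms(3) by (simp_all add: cliques_1)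

lemma remove_cliques:
  assumes "finite V" "R \<in> cliques V (Suc s)" "w \<in> R"
  shows "R - {w} \<in> cliques V s" "w \<in> common_nbrs V (R - {w})"
  using assms finite_subset[of R V] unfolding cliques_def common_nbrs_def
  by (auto simp: pairwise_def)

text \<open>Both sides sum over the pairs of an \<open>(s+1)\<close>-clique with a distinguished vertex.\<close>

lemma sum_clique_flags:
  fixes g :: "'a set \<Rightarrow> 'a \<Rightarrow> real"
  assumes "finite V"
  shows "(\<Sum>T\<in>cliques V s. \<Sum>w\<in>common_nbrs V T. g T w) =
         (\<Sum>R\<in>cliques V (Suc s). \<Sum>w\<in>R. g (R - {w}) w)"
proof -
  have "(\<Sum>T\<in>cliques V s. \<Sum>w\<in>common_nbrs V T. g T w) =
        (\<Sum>(T,w)\<in>(SIGMA T:cliques V s. common_nbrs V T). g T w)"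
    using assms by (subst sum.Sigma) auto
  also have "\<dots> = (\<Sum>(R,w)\<in>(SIGMA R:cliques V (Suc s). R). g (R - {w}) w)"
    by (rule sum.reindex_bij_witness[where i = "\<lambda>(R,w). (R - {w}, w)"
          and j = "\<lambda>(T,w). (insert w T, w)"])
       (use insert_cliques[OF assms] remove_cliques[OF assms] in auto)
  also have "\<dots> = (\<Sum>R\<in>cliques V (Suc s). \<Sum>w\<in>R. g (R - {w}) w)"
    using assms cliquesD(1)[OF assms] by (subst sum.Sigma) auto
  finally show ?thesis .
qed

lemma prod_clique_nonneg:
  fixes y :: "'a \<Rightarrow> real"
  assumes "\<And>v. v \<in> V \<Longrightarrow> y v \<ge> 0" "R \<in> cliques V s"
  shows "prod y R \<ge> 0"
  using assms by (intro prod_nonneg) (auto simp: cliques_def)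

lemma clique_weight_nonneg:
  assumes "\<And>v. v \<in> V \<Longrightarrow> y v \<ge> 0"
  shows "clique_weight V y s \<ge> 0"
  unfolding clique_weight_def using prod_clique_nonneg[OF assms] by (rule sum_nonneg)

lemma clique_weight_const:
  "finite V \<Longrightarrow> clique_weight V (\<lambda>_. c) s = real (card (cliques V s)) * c ^ s"
  using cliquesD(3) by (simp add: clique_weight_def)

lemma prod_remove_clique:
  fixes y :: "'a \<Rightarrow> real"
  assumes "finite V" "R \<in> cliques V s" "w \<in> R"
  shows "prod y (R - {w}) * y w = prod y R"
  using prod.remove[OF cliquesD(1)[OF assms(1,2)] assms(3), of y] by simp

lemma sum_prod_common_nbrs:
  assumes "finite V"
  shows "(\<Sum>T\<in>cliques V s. prod y T * sum y (common_nbrs V T)) =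
      real (Suc s) * clique_weight V y (Suc s)"
proof -
  have "(\<Sum>T\<in>cliques V s. prod y T * sum y (common_nbrs V T)) =
        (\<Sum>R\<in>cliques V (Suc s). \<Sum>w\<in>R. prod y (R - {w}) * y w)"
    using sum_clique_flags[OF assms, of "\<lambda>T w. prod y T * y w"] by (simp add: sum_distrib_left)
  also have "\<dots> = (\<Sum>R\<in>cliques V (Suc s). \<Sum>w\<in>R. prod y R)"
    by (intro sum.cong refl) (use prod_remove_clique[OF assms] in auto)
  also have "\<dots> = real (Suc s) * clique_weight V y (Suc s)"
    unfolding clique_weight_def sum_distrib_left
    by (intro sum.cong refl) (use cliquesD(3)[OF assms] in auto)
  finally show ?thesis .
qed

lemma clique_weight_0: "finite V \<Longrightarrow> clique_weight V y 0 = 1"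
  by (simp add: clique_weight_def cliques_0)

lemma clique_weight_1: "clique_weight V y (Suc 0) = sum y V"
  unfolding clique_weight_def cliques_1 by (subst sum.reindex) auto

lemma clique_weight_2:
  assumes "finite V"
  shows "2 * clique_weight V y 2 = adj_form V y"
proof -
  have "2 * clique_weight V y 2 = (\<Sum>T\<in>cliques V (Suc 0). prod y T * sum y (common_nbrs V T))"
    unfolding sum_prod_common_nbrs[OF assms] by (simp add: numeral_2_eq_2)
  also have "\<dots> = adj_form V y"
    unfolding cliques_1
    by (subst sum.reindex) (auto simp: adj_form_def sum_distrib_left common_nbrs_def nbrs_def)
  finally show ?thesis .
qed

lemma adj_form_le_sum_squared:
  assumes "finite V" "\<And>v. v \<in> V \<Longrightarrow> y v \<ge> 0"
  shows "adj_form V y \<le> (sum y V)\<^sup>2"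
proof -
  have "adj_form V y \<le> (\<Sum>u\<in>V. \<Sum>v\<in>V. y u * y v)"
    unfolding adj_form_def
    by (intro sum_mono sum_mono2) (use assms nbrs_subset in auto)
  also have "\<dots> = (sum y V)\<^sup>2" by (simp add: power2_eq_square sum_product)
  finally show ?thesis .
qed

subsection \<open>The Moon--Moser inequality\<close>

lemma card_common_nbrs_remove_le:
  assumes "finite R" "z \<in> V"
  shows "card {w \<in> R. z \<in> common_nbrs V (R - {w})} \<le> (if z \<in> common_nbrs V R then card R else 1)"
proof (cases "z \<in> common_nbrs V R")
  case True
  then show ?thesis using assms(1) by (simp add: card_mono)
next
  case False
  then obtain w where "w \<in> R" "\<not> E w z" using assms(2) by (auto simp: common_nbrs_def)
  then have "{w \<in> R. z \<in> common_nbrs V (R - {w})} \<subseteq> {w}" by (auto simp: common_nbrs_def)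
  then show ?thesis using False card_mono[of "{w}"] by fastforce
qed

lemma sum_common_nbrs:
  fixes y :: "'a \<Rightarrow> real"
  assumes "finite V"
  shows "sum y (common_nbrs V R) = (\<Sum>z\<in>V. if z \<in> common_nbrs V R then y z else 0)"
  using sum.inter_filter[OF assms, of y "\<lambda>z. z \<in> common_nbrs V R"]
  by (simp add: common_nbrs_def cong: conj_cong)

lemma sum_common_nbrs_remove_le:
  fixes y :: "'a \<Rightarrow> real"
  assumes "finite V" "\<And>v. v \<in> V \<Longrightarrow> y v \<ge> 0" "R \<in> cliques V (Suc s)"
  shows "(\<Sum>w\<in>R. sum y (common_nbrs V (R - {w}))) \<le> sum y V + real s * sum y (common_nbrs V R)"
proof -
  have R: "finite R" "card R = Suc s" using cliquesD[OF assms(1,3)] by auto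
  have "(\<Sum>w\<in>R. sum y (common_nbrs V (R - {w}))) =
        (\<Sum>z\<in>V. \<Sum>w\<in>R. if z \<in> common_nbrs V (R - {w}) then y z else 0)"
    unfolding sum_common_nbrs[OF assms(1)] by (rule sum.swap)
  also have "\<dots> = (\<Sum>z\<in>V. real (card {w \<in> R. z \<in> common_nbrs V (R - {w})}) * y z)"
    using R(1) by (intro sum.cong refl) (auto simp: sum.If_cases Int_def)
  also have "\<dots> \<le> (\<Sum>z\<in>V. y z + real s * (if z \<in> common_nbrs V R then y z else 0))"
  proof (rule sum_mono)
    fix z assume z: "z \<in> V"
    have "real (card {w \<in> R. z \<in> common_nbrs V (R - {w})}) * y z \<le>
          real (if z \<in> common_nbrs V R then Suc s else 1) * y z"
      using card_common_nbrs_remove_le[OF R(1) z] R(2) assms(2)[OF z]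
      by (intro mult_right_mono) auto
    also have "\<dots> = y z + real s * (if z \<in> common_nbrs V R then y z else 0)"
      by (simp add: distrib_right)
    finally show "real (card {w \<in> R. z \<in> common_nbrs V (R - {w})}) * y z \<le>
      y z + real s * (if z \<in> common_nbrs V R then y z else 0)" .
  qed
  also have "\<dots> = sum y V + real s * sum y (common_nbrs V R)"
    by (simp add: sum.distrib sum_distrib_left[symmetric] sum_common_nbrs[OF assms(1)])
  finally show ?thesis .
qed

lemma sum_prod_common_nbrs_squared_le:
  assumes "finite V" "\<And>v. v \<in> V \<Longrightarrow> y v \<ge> 0"
  shows "(\<Sum>T\<in>cliques V s. prod y T * (sum y (common_nbrs V T))\<^sup>2) \<le>
    sum y V * clique_weight V y (Suc s) + real s * (real (s + 2) * clique_weight V y (s + 2))"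
proof -
  let ?d = "\<lambda>T. sum y (common_nbrs V T)"
  have "(\<Sum>T\<in>cliques V s. prod y T * (?d T)\<^sup>2) =
      (\<Sum>T\<in>cliques V s. \<Sum>w\<in>common_nbrs V T. prod y T * y w * ?d T)"
    by (simp add: power2_eq_square mult.assoc flip: sum_distrib_left sum_distrib_right)
  also have "\<dots> = (\<Sum>R\<in>cliques V (Suc s). \<Sum>w\<in>R. prod y (R - {w}) * y w * ?d (R - {w}))"
    by (rule sum_clique_flags[OF assms(1)])
  also have "\<dots> = (\<Sum>R\<in>cliques V (Suc s). prod y R * (\<Sum>w\<in>R. ?d (R - {w})))"
    unfolding sum_distrib_left
    by (intro sum.cong refl) (simp add: prod_remove_clique[OF assms(1)])
  also have "\<dots> \<le> (\<Sum>R\<in>cliques V (Suc s). prod y R * (sum y V + real s * ?d R))"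
    using prod_clique_nonneg[of V y] assms
    by (intro sum_mono mult_left_mono sum_common_nbrs_remove_le) auto
  also have "\<dots> =
      sum y V * clique_weight V y (Suc s) + real s * (\<Sum>R\<in>cliques V (Suc s). prod y R * ?d R)"
    unfolding clique_weight_def sum.distrib[symmetric]
      sum_distrib_left[where A = "cliques V (Suc s)"]
    by (intro sum.cong refl) (simp add: distrib_left mult.left_commute mult.commute)
  finally show ?thesis
    using sum_prod_common_nbrs[OF assms(1), where s = "Suc s"] by simp
qed

lemma moon_moser_weighted:
  assumes "finite V" "\<And>v. v \<in> V \<Longrightarrow> y v \<ge> 0"
  shows "(real (Suc s) * clique_weight V y (Suc s))\<^sup>2 \<le>
    clique_weight V y s * (sum y V * clique_weight V y (Suc s)
      + real s * (real (s + 2) * clique_weight V y (s + 2)))"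
proof -
  let ?d = "\<lambda>T. sum y (common_nbrs V T)"
  have pos: "prod y T \<ge> 0" if "T \<in> cliques V s" for T
    using prod_clique_nonneg[OF assms(2) that] .
  have "(real (Suc s) * clique_weight V y (Suc s))\<^sup>2 =
      (\<Sum>T\<in>cliques V s. sqrt (prod y T) * (sqrt (prod y T) * ?d T))\<^sup>2"
    unfolding sum_prod_common_nbrs[OF assms(1), symmetric]
    using pos by (simp add: mult.assoc[symmetric])
  also have "\<dots> \<le>
      (\<Sum>T\<in>cliques V s. (sqrt (prod y T))\<^sup>2) * (\<Sum>T\<in>cliques V s. (sqrt (prod y T) * ?d T)\<^sup>2)"
    by (rule Cauchy_Schwarz_ineq_sum)
  also have "\<dots> = clique_weight V y s * (\<Sum>T\<in>cliques V s. prod y T * (?d T)\<^sup>2)"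
    unfolding clique_weight_def using pos by (simp add: power_mult_distrib)
  also have "\<dots> \<le> clique_weight V y s * (sum y V * clique_weight V y (Suc s)
      + real s * (real (s + 2) * clique_weight V y (s + 2)))"
    using sum_prod_common_nbrs_squared_le[OF assms] clique_weight_nonneg[OF assms(2)]
    by (intro mult_left_mono) auto
  finally show ?thesis .
qed

lemma clique_weight_ratio:
  assumes V: "finite V" "\<And>v. v \<in> V \<Longrightarrow> y v \<ge> 0" "sum y V = 1"
  shows "(1 - real s * (1 - adj_form V y)) * clique_weight V y s \<le>
      real (Suc s) * clique_weight V y (Suc s)"
proof (induction s)
  case 0
  then show ?case using V by (simp add: clique_weight_0 clique_weight_1)
next
  case (Suc s)
  let ?k = "clique_weight V y"
  let ?p = "\<lambda>i::nat. 1 - real i * (1 - adj_form V y)"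
  have nonneg: "?k i \<ge> 0" for i by (rule clique_weight_nonneg[OF V(2)])
  have t: "adj_form V y \<le> 1" using adj_form_le_sum_squared[of V y] V by simp
  have moon_moser: "(real (Suc s) * ?k (Suc s))\<^sup>2 \<le>
      ?k s * (?k (Suc s) + real s * (real (s + 2) * ?k (s + 2)))"
    using moon_moser_weighted[of V y s] V by simp
  consider (zero) "s = 0" | (vanishing) "?k s = 0" | (positive) "s > 0" "?k s > 0"
    using nonneg[of s] by linarith
  then show ?case
  proof cases
    case zero
    then show ?thesis
      using V clique_weight_2[OF V(1), of y] by (simp add: clique_weight_1 numeral_2_eq_2)
  next
    case vanishing
    then have "?k (Suc s) = 0" using moon_moser by simp
    then show ?thesis using nonneg[of "Suc (Suc s)"] by simp
  next
    case positive
    have "?k s * (?p s * (real (Suc s) * ?k (Suc s))) = (?p s * ?k s) * (real (Suc s) * ?k (Suc s))"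
      by simp
    also have "\<dots> \<le> (real (Suc s) * ?k (Suc s)) * (real (Suc s) * ?k (Suc s))"
      using Suc.IH nonneg by (intro mult_right_mono) auto
    also have "\<dots> \<le> ?k s * (?k (Suc s) + real s * (real (s + 2) * ?k (s + 2)))"
      using moon_moser by (simp only: power2_eq_square)
    finally have "?p s * (real (Suc s) * ?k (Suc s)) \<le>
        ?k (Suc s) + real s * (real (s + 2) * ?k (s + 2))"
      using positive by simp
    then have "real s * (?p (Suc s) * ?k (Suc s)) \<le> real s * (real (s + 2) * ?k (s + 2))"
      by (simp add: algebra_simps)
    then show ?thesis using positive by simp
  qed
qed

lemma prod_le_fact_clique_weight:
  assumes V: "finite V" "\<And>v. v \<in> V \<Longrightarrow> y v \<ge> 0" "sum y V = 1"
    and t: "1 - \<tau> \<le> adj_form V y" and "\<And>i. i < s \<Longrightarrow> real i * \<tau> \<le> 1"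
  shows "(\<Prod>i<s. 1 - real i * \<tau>) \<le> fact s * clique_weight V y s"
  using assms(5)
proof (induction s)
  case 0
  then show ?case using V(1) by (simp add: clique_weight_0)
next
  case (Suc s)
  let ?k = "clique_weight V y"
  have "(\<Prod>i<Suc s. 1 - real i * \<tau>) = (\<Prod>i<s. 1 - real i * \<tau>) * (1 - real s * \<tau>)" by simp
  also have "\<dots> \<le> (fact s * ?k s) * (1 - real s * \<tau>)"
    using Suc by (intro mult_right_mono) auto
  also have "\<dots> \<le> (fact s * ?k s) * (1 - real s * (1 - adj_form V y))"
    using t clique_weight_nonneg[OF V(2)]
    by (intro mult_left_mono diff_left_mono mult_left_mono) auto
  also have "\<dots> \<le> fact s * (real (Suc s) * ?k (Suc s))"
    using mult_left_mono[OF clique_weight_ratio[OF V, where s = s], of "fact s"]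
    by (simp add: mult_ac)
  finally show ?case by (simp add: mult_ac)
qed

lemma adj_form_const: "adj_form V (\<lambda>_. c) = real (degree_sum V) * c\<^sup>2"
  by (simp add: adj_form_def degree_sum_def degree_def power2_eq_square sum_distrib_right)

lemma prod_le_fact_card_cliques:
  assumes U: "finite U" and g: "\<And>u. u \<in> U \<Longrightarrow> real (card (non_nbrs U u)) \<le> g"
    and "\<And>i. i < s \<Longrightarrow> real i * g \<le> real (card U)"
  shows "(\<Prod>i<s. real (card U) - real i * g) \<le> fact s * real (card (cliques U s))"
proof (cases "U = {}")
  case True
  show ?thesis
  proof (cases "s = 0")
    case False
    then have "(\<Prod>i<s. real (card U) - real i * g) = 0"
      using True by (intro prod_zero) auto
    also have "0 \<le> fact s * real (card (cliques U s))" by simp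
    finally show ?thesis .
  qed (simp add: cliques_0 U)
next
  case False
  define m where "m = real (card U)"
  have m: "m > 0" using False U by (simp add: m_def card_gt_0_iff)
  have "(m - g) * m = (\<Sum>u\<in>U. m - g)" by (simp add: m_def)
  also have "\<dots> \<le> real (degree_sum U)"
    unfolding degree_sum_def of_nat_sum
    using g by (intro sum_mono) (auto simp: real_degree[OF U] m_def)
  finally have "(m - g) * m / m\<^sup>2 \<le> real (degree_sum U) / m\<^sup>2"
    by (rule divide_right_mono) simp
  moreover have "(m - g) * m / m\<^sup>2 = 1 - g / m"
    using m by (simp add: diff_divide_distrib power2_eq_square)
  ultimately have form: "1 - g / m \<le> adj_form U (\<lambda>_. 1 / m)"
    by (simp add: adj_form_const power_divide)
  have "(\<Prod>i<s. m - real i * g) = m ^ s * (\<Prod>i<s. 1 - real i * (g / m))"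
    using m prod.distrib[of "\<lambda>_. m" "\<lambda>i. 1 - real i * (g / m)" "{..<s}"]
    by (simp add: right_diff_distrib)
  also have "\<dots> \<le> m ^ s * (fact s * clique_weight U (\<lambda>_. 1 / m) s)"
  proof (rule mult_left_mono[OF prod_le_fact_clique_weight[OF U _ _ form]])
    show "real i * (g / m) \<le> 1" if "i < s" for i
      using assms(3)[OF that] m by (simp add: m_def)
  qed (use m in \<open>auto simp: m_def\<close>)
  also have "\<dots> = fact s * real (card (cliques U s))"
    using m U by (simp add: clique_weight_const power_divide)
  finally show ?thesis by (simp add: m_def)
qed

section \<open>Graphs whose edges lie in few cliques\<close>

definition edge_cliques_le :: "'a set \<Rightarrow> nat \<Rightarrow> real \<Rightarrow> bool" where
  "edge_cliques_le V s J \<longleftrightarrow> (\<forall>T\<in>cliques V 2. real (card (clique_extensions V s T)) \<le> J)"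

lemma edge_cliques_le_mono:
  assumes "finite V" "W \<subseteq> V" "edge_cliques_le V s J" "J \<le> J'"
  shows "edge_cliques_le W s J'"
  unfolding edge_cliques_le_def
proof
  fix T assume T: "T \<in> cliques W 2"
  have "card (clique_extensions W s T) \<le> card (clique_extensions V s T)"
    using assms(1) cliques_mono[OF assms(2)] by (intro card_mono) (auto simp: clique_extensions_def)
  moreover have "real (card (clique_extensions V s T)) \<le> J"
    using assms(3) T cliques_mono[OF assms(2)] unfolding edge_cliques_le_def by blast
  ultimately show "real (card (clique_extensions W s T)) \<le> J'" using assms(4) by linarith
qed

lemma sum_clique_extensions:
  assumes "finite V"
  shows "(\<Sum>T\<in>cliques V j. \<Sum>R\<in>clique_extensions V s T. f T R) =
         (\<Sum>R\<in>cliques V s. \<Sum>T | T \<subseteq> R \<and> card T = j. f T R)"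
proof -
  have "{T \<in> cliques V j. T \<subseteq> R} = {T. T \<subseteq> R \<and> card T = j}" if "R \<in> cliques V s" for R
    using subset_cliques[OF that] by (auto simp: cliques_def)
  then show ?thesis
    unfolding clique_extensions_def
    by (subst sum.swap_restrict) (use assms in \<open>auto intro: sum.cong\<close>)
qed

lemma binomial_clique_weight_le:
  assumes V: "finite V" "\<And>v. v \<in> V \<Longrightarrow> 0 \<le> y v \<and> y v \<le> Y" "0 \<le> Y"
    and J: "\<And>T. T \<in> cliques V j \<Longrightarrow> real (card (clique_extensions V s T)) \<le> J"
  shows "real (s choose j) * clique_weight V y s \<le> J * Y ^ (s - j) * clique_weight V y j"
proof -
  have prod_le: "prod y R \<le> prod y T * Y ^ (s - j)"
    if "T \<in> cliques V j" "R \<in> clique_extensions V s T" for T R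
  proof -
    have R: "finite R" "R \<subseteq> V" "card R = s" "T \<subseteq> R"
      using that(2) cliquesD[OF V(1)] unfolding clique_extensions_def by blast+
    have "card T = j" using cliquesD[OF V(1) that(1)] by simp
    then have "card (R - T) = s - j"
      using R finite_subset[OF R(4,1)] by (simp add: card_Diff_subset)
    moreover have "prod y (R - T) \<le> (\<Prod>v\<in>R - T. Y)"
      using R V(2) by (intro prod_mono) auto
    ultimately have "prod y (R - T) \<le> Y ^ (s - j)" by simp
    then show ?thesis
      using prod.subset_diff[OF R(4,1), of y] prod_clique_nonneg[OF _ that(1), of y] V(2)
      by (simp add: mult.commute mult_left_mono)
  qed
  have "real (s choose j) * clique_weight V y s =
      (\<Sum>R\<in>cliques V s. \<Sum>T | T \<subseteq> R \<and> card T = j. prod y R)"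
    unfolding clique_weight_def sum_distrib_left
    by (intro sum.cong refl) (use cliquesD[OF V(1)] in \<open>simp add: n_subsets\<close>)
  also have "\<dots> = (\<Sum>T\<in>cliques V j. \<Sum>R\<in>clique_extensions V s T. prod y R)"
    by (rule sum_clique_extensions[OF V(1), symmetric])
  also have "\<dots> \<le> (\<Sum>T\<in>cliques V j. \<Sum>R\<in>clique_extensions V s T. prod y T * Y ^ (s - j))"
    by (intro sum_mono prod_le)
  also have "\<dots> \<le> (\<Sum>T\<in>cliques V j. J * (prod y T * Y ^ (s - j)))"
    unfolding sum_constant using prod_clique_nonneg[of V y] V
    by (intro sum_mono mult_right_mono mult_nonneg_nonneg J) auto
  also have "\<dots> = J * Y ^ (s - j) * clique_weight V y j"
    by (simp add: clique_weight_def sum_distrib_left mult_ac)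
  finally show ?thesis .
qed

text \<open>With \<open>J = 0\<close> this is the theorem of Motzkin and Straus.\<close>

theorem motzkin_straus_edge_cliques:
  assumes V: "finite V" "\<And>v. v \<in> V \<Longrightarrow> 0 \<le> y v \<and> y v \<le> Y" "sum y V = 1"
    and J: "0 \<le> J" "edge_cliques_le V (Suc r) J" and r: "r \<ge> 2" and Y: "0 \<le> Y"
  shows "adj_form V y \<le> 1 - 1 / real r + Y ^ (r - 1) * J * real r ^ (r - 2)"
proof (cases "adj_form V y > 1 - 1 / real r")
  case True
  let ?k = "clique_weight V y" and ?t = "adj_form V y"
  have r0: "real r > 0" using r by simp
  have y: "\<And>v. v \<in> V \<Longrightarrow> y v \<ge> 0" using V(2) by blast
  have p: "0 \<le> 1 - real r * (1 - ?t)" using True r0 by (simp add: field_simps)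
  have t: "?t \<le> 1" using adj_form_le_sum_squared[of V y] V(1,3) y by simp
  have "fact r * (1 / real r) ^ r \<le> (\<Prod>i<r. 1 - real i * (1 / real r))"
    using r0 by (intro fact_mult_power_le_prod) (auto simp: field_simps)
  also have "\<dots> \<le> fact r * ?k r"
    using r0 True by (intro prod_le_fact_clique_weight V y) auto
  finally have k: "(1 / real r) ^ r \<le> ?k r" by simp
  have "real r * ((1 - real r * (1 - ?t)) * (1 / real r) ^ r) \<le>
      real r * ((1 - real r * (1 - ?t)) * ?k r)"
    using k p by (intro mult_left_mono) auto
  also have "\<dots> \<le> real r * (real (Suc r) * ?k (Suc r))"
    using clique_weight_ratio[OF V(1) y V(3), where s = r] by (intro mult_left_mono) auto
  also have "\<dots> = 2 * (real (Suc r choose 2) * ?k (Suc r))"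
    by (simp add: choose_two real_of_nat_div algebra_simps)
  also have "\<dots> \<le> 2 * (J * Y ^ (r - 1) * ?k 2)"
    using binomial_clique_weight_le[OF V(1,2) Y, where j = 2 and s = "Suc r"] J(2) r
    by (auto simp: edge_cliques_le_def)
  also have "\<dots> = J * Y ^ (r - 1) * ?t" using clique_weight_2[OF V(1), of y] by simp
  also have "\<dots> \<le> J * Y ^ (r - 1) * 1"
    using t J(1) Y by (intro mult_left_mono) auto
  finally have "real r * (1 - real r * (1 - ?t)) \<le> Y ^ (r - 1) * J * real r ^ r"
    using r0 by (simp add: field_simps)
  also have "real r ^ r = real r ^ (r - 2) * (real r)\<^sup>2"
    using power_add[of "real r" "r - 2" 2] by (simp only: le_add_diff_inverse2[OF r])
  also have "real r * (1 - real r * (1 - ?t)) = (?t - (1 - 1 / real r)) * (real r)\<^sup>2"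
    using r0 by (simp add: field_simps power2_eq_square)
  finally have "?t - (1 - 1 / real r) \<le> Y ^ (r - 1) * J * real r ^ (r - 2)"
    using r0 by simp
  then show ?thesis by simp
next
  case False
  have "Y ^ (r - 1) * J * real r ^ (r - 2) \<ge> 0" using J Y by simp
  then show ?thesis using False by linarith
qed

lemma card_cliques_common_nbrs_le:
  assumes "finite V" "T \<in> cliques V k"
  shows "card (cliques (common_nbrs V T) s) \<le> card (clique_extensions V (k + s) T)"
proof (rule card_inj_on_le)
  show "inj_on ((\<union>) T) (cliques (common_nbrs V T) s)"
    using union_cliques(2)[OF assms] by (intro inj_onI) blast
  show "(\<union>) T ` cliques (common_nbrs V T) s \<subseteq> clique_extensions V (k + s) T"
    using union_cliques(1)[OF assms] by (auto simp: clique_extensions_def)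
qed (use assms in simp)

subsection \<open>An edge of large codegree in a clique\<close>

lemma sum_degree_swap:
  assumes "finite K" "finite W"
  shows "(\<Sum>w\<in>W. degree K w) = (\<Sum>u\<in>K. degree W u)"
proof -
  have "\<forall>u\<in>K. card {w \<in> W. E w u} = degree W u"
    by (simp add: degree_def nbrs_def adj_commute[of _ u for u])
  from sum_multicount_gen[OF assms(2,1) this] show ?thesis by (simp add: degree_def nbrs_def)
qed

lemma sum_card_common_nbrs:
  assumes "finite K" "finite W"
  shows "(\<Sum>u\<in>K. \<Sum>v\<in>K. card (common_nbrs W {u, v})) = (\<Sum>w\<in>W. (degree K w)\<^sup>2)"
proof -
  have "\<forall>w\<in>W. card {p \<in> K \<times> K. E (fst p) w \<and> E (snd p) w} = (degree K w)\<^sup>2"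
  proof
    fix w
    have "{p \<in> K \<times> K. E (fst p) w \<and> E (snd p) w} = nbrs K w \<times> nbrs K w"
      using sym by (auto simp: nbrs_def)
    then show "card {p \<in> K \<times> K. E (fst p) w \<and> E (snd p) w} = (degree K w)\<^sup>2"
      by (simp add: card_cartesian_product degree_def power2_eq_square)
  qed
  from sum_multicount_gen[OF _ assms(2) this] show ?thesis
    using assms(1) by (simp add: common_nbrs_def sum.cartesian_product case_prod_unfold)
qed

lemma sum_codegree_ge:
  assumes K: "finite K" and W: "finite W"
  shows "2 * (real r - 1) * (\<Sum>u\<in>K. real (degree W u)) - real r * (real r - 1) * real (card W)
    \<le> (\<Sum>u\<in>K. \<Sum>v\<in>K - {u}. real (card (common_nbrs W {u, v})))"
proof -
  have square_ge: "(2 * real r - 1) * real d - real r * (real r - 1) \<le> (real d)\<^sup>2" for d :: nat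
  proof -
    have "0 \<le> (int d - int r) * (int d - int r + 1)"
      by (cases "int d - int r \<ge> 0") (auto simp: mult_nonneg_nonneg mult_nonpos_nonpos)
    then have "0 \<le> real_of_int ((int d - int r) * (int d - int r + 1))"
      by (simp only: of_int_0_le_iff)
    then show ?thesis by (simp add: algebra_simps power2_eq_square)
  qed
  have degrees: "(\<Sum>u\<in>K. real (degree W u)) = (\<Sum>w\<in>W. real (degree K w))"
    unfolding of_nat_sum[symmetric] sum_degree_swap[OF K W] ..
  have "(2 * real r - 1) * (\<Sum>u\<in>K. real (degree W u)) - real r * (real r - 1) * real (card W)
      = (\<Sum>w\<in>W. (2 * real r - 1) * real (degree K w) - real r * (real r - 1))"
    by (simp add: sum_subtractf sum_distrib_left degrees)
  also have "\<dots> \<le> (\<Sum>w\<in>W. (real (degree K w))\<^sup>2)" by (intro sum_mono square_ge)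
  also have "\<dots> = (\<Sum>u\<in>K. \<Sum>v\<in>K. real (card (common_nbrs W {u, v})))"
    by (simp add: sum_card_common_nbrs[OF K W] flip: of_nat_sum of_nat_power)
  also have "\<dots> = (\<Sum>u\<in>K. real (degree W u) + (\<Sum>v\<in>K - {u}. real (card (common_nbrs W {u, v}))))"
    by (intro sum.cong refl) (simp add: sum.remove[OF K] degree_def common_nbrs_def nbrs_def)
  finally show ?thesis by (simp add: sum.distrib algebra_simps)
qed

lemma ex_large_codegree:
  assumes W: "finite W" and K: "card K = Suc r" and r: "r \<ge> 1"
    and d: "\<And>u. u \<in> K \<Longrightarrow> d \<le> real (degree W u)"
  shows "\<exists>u\<in>K. \<exists>v\<in>K. u \<noteq> v \<and>
    2 * (real r - 1) / real r * d - (real r - 1) / (real r + 1) * real (card W) \<le>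
        real (card (common_nbrs W {u, v}))"
proof (rule ccontr)
  define B where "B = 2 * (real r - 1) / real r * d - (real r - 1) / (real r + 1) * real (card W)"
  assume "\<not> ?thesis"
  then have less: "real (card (common_nbrs W {u, v})) < B" if "u \<in> K" "v \<in> K - {u}" for u v
    using that unfolding B_def by force
  have finite: "finite K" using K by (simp add: card_ge_0_finite)
  have r0: "real r > 0" using r by simp
  have "(real r + 1) * d = (\<Sum>u\<in>K. d)" using K by simp
  also have "\<dots> \<le> (\<Sum>u\<in>K. real (degree W u))" by (rule sum_mono[OF d])
  finally have "2 * (real r - 1) * ((real r + 1) * d) - real r * (real r - 1) * real (card W)
      \<le> 2 * (real r - 1) * (\<Sum>u\<in>K. real (degree W u)) - real r * (real r - 1) * real (card W)"
    using r by (intro diff_right_mono mult_left_mono) auto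
  also have "\<dots> \<le> (\<Sum>u\<in>K. \<Sum>v\<in>K - {u}. real (card (common_nbrs W {u, v})))"
    by (rule sum_codegree_ge[OF finite W])
  also have "\<dots> < (\<Sum>u\<in>K. \<Sum>v\<in>K - {u}. B)"
  proof (intro sum_strict_mono)
    show "K - {u} \<noteq> {}" if "u \<in> K" for u
      using card_Diff_singleton[OF that] K r by (metis card.empty diff_Suc_1 not_one_le_zero)
  qed (use finite K less in auto)
  also have "\<dots> = real r * (real r + 1) * B" using K finite by simp
  also have "\<dots> = 2 * (real r - 1) * ((real r + 1) * d) - real r * (real r - 1) * real (card W)"
    using r0 by (simp add: B_def divide_simps)
  finally show False by simp
qed

lemma card_cliques_Suc_ge:
  assumes U: "finite U" and g: "\<And>u. u \<in> U \<Longrightarrow> real (card (non_nbrs U u)) \<le> g"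
    and "0 \<le> h" "0 \<le> c"
    and excess: "\<And>i. i \<le> q \<Longrightarrow> (real q - real i) * h + c \<le> real (card U) - real i * g"
  shows "h ^ q * c \<le> real (Suc q) * real (card (cliques U (Suc q)))"
proof -
  have factor_ge: "(real q - real i) * h \<le> real (card U) - real i * g" if "i \<le> q" for i
    using excess[OF that] \<open>0 \<le> c\<close> by linarith
  have factor_nonneg: "0 \<le> real (card U) - real i * g" if "i \<le> q" for i
    by (rule order_trans[OF _ factor_ge[OF that]]) (use \<open>0 \<le> h\<close> that in simp)
  have "fact q * (h ^ q * c) = (fact q * h ^ q) * c" by simp
  also have "\<dots> \<le> (\<Prod>i<q. real (card U) - real i * g) * (real (card U) - real q * g)"
  proof (rule mult_mono)
    show "fact q * h ^ q \<le> (\<Prod>i<q. real (card U) - real i * g)"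
      using factor_ge \<open>0 \<le> h\<close> by (intro fact_mult_power_le_prod) auto
    show "c \<le> real (card U) - real q * g" using excess[of q] by simp
    show "0 \<le> (\<Prod>i<q. real (card U) - real i * g)"
      using factor_nonneg by (intro prod_nonneg) auto
  qed fact
  also have "\<dots> = (\<Prod>i<Suc q. real (card U) - real i * g)" by simp
  also have "\<dots> \<le> fact (Suc q) * real (card (cliques U (Suc q)))"
    using factor_nonneg by (intro prod_le_fact_card_cliques U g) (auto simp: less_Suc_eq_le)
  also have "\<dots> = fact q * (real (Suc q) * real (card (cliques U (Suc q))))" by simp
  finally show ?thesis by (simp only: mult_le_cancel_left_pos fact_gt_zero)
qed

lemma ex_edge_large_codegree:
  assumes W: "finite W" and r: "r \<ge> 1" and K: "K \<in> cliques W (Suc r)"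
    and non_nbrs: "\<And>u. u \<in> W \<Longrightarrow> real (card (non_nbrs W u)) \<le> g"
  shows "\<exists>u v. {u, v} \<in> cliques W 2 \<and>
    2 * (real r - 1) / real r * (real (card W) - g) - (real r - 1) / (real r + 1) * real (card W)
      \<le> real (card (common_nbrs W {u, v}))"
proof -
  note clique = cliquesD[OF W K]
  have "real (card W) - g \<le> real (degree W u)" if "u \<in> K" for u
    using that clique(2) non_nbrs[of u] by (auto simp: real_degree[OF W])
  from ex_large_codegree[OF W clique(3) r this]
  obtain u v where "u \<in> K" "v \<in> K" "u \<noteq> v"
    and codegree: "2 * (real r - 1) / real r * (real (card W) - g)
      - (real r - 1) / (real r + 1) * real (card W) \<le> real (card (common_nbrs W {u, v}))"
    by blast
  then have "{u, v} \<in> cliques W 2" using clique by (auto simp: doubleton_cliques pairwise_def)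
  then show ?thesis using codegree by blast
qed

lemma ex_edge_many_extensions:
  assumes W: "finite W" and r: "r \<ge> 2" and K: "K \<in> cliques W (Suc r)"
    and non_nbrs: "\<And>u. u \<in> W \<Longrightarrow> real (card (non_nbrs W u)) \<le>
        (1 / real r + 1 / (2 * real r ^ 4)) * real (card W)"
  shows "\<exists>T\<in>cliques W 2. 5 / (6 * real r ^ 3) * (real (card W) / real r) ^ (r - 1)
    \<le> real (card (clique_extensions W (Suc r) T))"
proof -
  define m where "m = real (card W)"
  define e where "e = 1 / (2 * real r ^ 4)"
  define g where "g = (1 / real r + e) * m"
  obtain q where q: "r = q + 2" using r le_Suc_ex by (metis add.commute)
  have r0: "real r \<ge> 2" using r by simp
  have gW: "real (card (non_nbrs W w)) \<le> g" if "w \<in> W" for w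
    using non_nbrs[OF that] by (simp add: g_def e_def m_def)
  obtain u v where uv: "{u, v} \<in> cliques W 2"
    and codegree: "2 * (real r - 1) / real r * (m - g) - (real r - 1) / (real r + 1) * m
      \<le> real (card (common_nbrs W {u, v}))"
    using ex_edge_large_codegree[OF W _ K gW] r unfolding m_def by auto
  define U where "U = common_nbrs W {u, v}"
  have U: "finite U" "U \<subseteq> W" using W by (auto simp: U_def common_nbrs_def)
  have gU: "real (card (non_nbrs U w)) \<le> g" if "w \<in> U" for w
    using card_non_nbrs_mono[OF W U(2), of w] gW[of w] that U(2) by auto
  have excess: "(real q - real i) * (m / real r) + m * (5 / (6 * real r ^ 3)) \<le>
      real (card U) - real i * g"
    if "i \<le> q" for i
  proof -
    have "(real q - real i) * (m / real r) + m * (5 / (6 * real r ^ 3)) =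
        m * ((real r - 2 - real i) / real r + 5 / (6 * real r ^ 3))"
      by (simp add: q distrib_left)
    also have "\<dots> \<le>
        m * (2 * (real r - 1) / real r * (1 - 1 / real r - e) - (real r - 1) / (real r + 1)
          - real i * (1 / real r + e))"
      using codegree_excess[OF r0, of "real i"] that q
      unfolding e_def m_def by (intro mult_left_mono) auto
    also have "\<dots> =
        2 * (real r - 1) / real r * (m - g) - (real r - 1) / (real r + 1) * m - real i * g"
      by (simp add: g_def algebra_simps)
    finally show ?thesis using codegree by (simp add: U_def)
  qed
  have "(m / real r) ^ q * (m * (5 / (6 * real r ^ 3))) \<le>
      real (Suc q) * real (card (cliques U (Suc q)))"
    by (intro card_cliques_Suc_ge[OF U(1) gU] excess) (simp_all add: m_def)
  also have "\<dots> \<le> real r * real (card (cliques U (Suc q)))"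
    by (intro mult_right_mono) (auto simp: q)
  finally have "5 / (6 * real r ^ 3) * (m / real r) ^ Suc q \<le> real (card (cliques U (Suc q)))"
    using r0 by (simp add: field_simps)
  also have "card (cliques U (Suc q)) \<le> card (clique_extensions W (Suc r) {u, v})"
    using card_cliques_common_nbrs_le[OF W uv, of "Suc q"] by (simp add: q U_def)
  finally have "5 / (6 * real r ^ 3) * (m / real r) ^ (r - 1) \<le>
      real (card (clique_extensions W (Suc r) {u, v}))"
    by (simp add: q)
  then show ?thesis using uv unfolding m_def by blast
qed

lemma clique_free_of_edge_cliques_le:
  assumes W: "finite W" and r: "r \<ge> 2"
    and J: "edge_cliques_le W (Suc r) (\<gamma> * real (card W) ^ (r - 1))"
    and \<gamma>: "\<gamma> < 5 / (6 * real r ^ (r + 2))"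
    and non_nbrs: "\<And>u. u \<in> W \<Longrightarrow> real (card (non_nbrs W u)) \<le>
        (1 / real r + 1 / (2 * real r ^ 4)) * real (card W)"
  shows "cliques W (Suc r) = {}"
proof (rule ccontr)
  assume "cliques W (Suc r) \<noteq> {}"
  then obtain K T where K: "K \<in> cliques W (Suc r)" and T: "T \<in> cliques W 2"
    and many: "5 / (6 * real r ^ 3) * (real (card W) / real r) ^ (r - 1) \<le>
        real (card (clique_extensions W (Suc r) T))"
    using ex_edge_many_extensions[OF W r _ non_nbrs] by blast
  have "W \<noteq> {}" using cliquesD[OF W K] by auto
  then have m: "real (card W) ^ (r - 1) > 0" using W by (simp add: card_gt_0_iff)
  have "real r ^ 3 * real r ^ (r - 1) = real r ^ (r + 2)" using r by (simp flip: power_add)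
  then have "5 / (6 * real r ^ (r + 2)) * real (card W) ^ (r - 1) =
      5 / (6 * real r ^ 3) * (real (card W) / real r) ^ (r - 1)"
    by (simp add: power_divide)
  also have "\<dots> \<le> \<gamma> * real (card W) ^ (r - 1)"
    using many J T unfolding edge_cliques_le_def by fastforce
  finally show False using mult_strict_right_mono[OF \<gamma> m] by linarith
qed

section \<open>The theorem of Andrasfai, Erdos and Sos\<close>

definition proper_colouring :: "'a set \<Rightarrow> nat \<Rightarrow> ('a \<Rightarrow> nat) \<Rightarrow> bool" where
  "proper_colouring V r c \<longleftrightarrow> (\<forall>u\<in>V. c u < r) \<and> (\<forall>u\<in>V. \<forall>v\<in>V. E u v \<longrightarrow> c u \<noteq> c v)"

text \<open>Adding an edge between two nonadjacent vertices completes an \<open>(s+2)\<close>-clique.\<close>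

definition saturated :: "'a set \<Rightarrow> nat \<Rightarrow> bool" where
  "saturated V s \<longleftrightarrow>
     (\<forall>x\<in>V. \<forall>y\<in>V. x \<noteq> y \<longrightarrow> \<not> E x y \<longrightarrow> (\<exists>P\<in>cliques V s. P \<subseteq> common_nbrs V {x, y}))"

text \<open>Brandt's configuration: in a saturated graph it arises from a vertex \<open>x\<close> that is adjacent to
  neither end of the edge \<open>y z\<close>.\<close>

definition wheel_like :: "'a set \<Rightarrow> nat \<Rightarrow> nat \<Rightarrow> 'a \<Rightarrow> 'a \<Rightarrow> 'a \<Rightarrow> 'a set \<Rightarrow> 'a set \<Rightarrow> bool" where
  "wheel_like V s k x y z P Q \<longleftrightarrow> P \<in> cliques V s \<and> Q \<in> cliques V s \<and> card (P \<inter> Q) = k \<and>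
     x \<in> common_nbrs V (P \<union> Q) \<and> y \<in> common_nbrs V P \<and> z \<in> common_nbrs V Q \<and> E y z"

lemma not_adjacent_of_clique_free:
  assumes "finite V" "cliques V (s + 2) = {}" "R \<in> cliques V s"
    and "v \<in> common_nbrs V R" "w \<in> common_nbrs V R"
  shows "\<not> E v w"
proof
  assume "E v w"
  then have "v \<in> common_nbrs V (insert w R)" using assms(4) sym by (auto simp: common_nbrs_def)
  then have "insert v (insert w R) \<in> cliques V (s + 2)"
    using insert_cliques(1)[OF assms(1) insert_cliques(1)[OF assms(1,3,5)]] by simp
  then show False using assms(2) by simp
qed

lemma mem_common_nbrs_iff: "v \<in> V \<Longrightarrow> v \<in> common_nbrs V R \<longleftrightarrow> non_nbrs R v = {}"
  unfolding common_nbrs_def non_nbrs_def using sym by blast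

lemma card_non_nbrs_singleton: "card (non_nbrs {w} v) = (if E v w then 0 else 1)"
proof -
  have "non_nbrs {w} v = (if E v w then {} else {w})" by (auto simp: non_nbrs_def)
  then show ?thesis by simp
qed

text \<open>A vertex that misses one vertex of \<open>P\<close> and one of \<open>Q\<close> can replace both, which enlarges
  \<open>P \<inter> Q\<close>.\<close>

lemma wheel_like_swap:
  assumes V: "finite V" and wheel: "wheel_like V s k x y z P Q"
    and v: "v \<in> V" "E v x" "E v y" "E v z"
    and missed: "non_nbrs P v = {a}" "non_nbrs Q v = {b}" "non_nbrs (P \<inter> Q) v = {}"
  shows "wheel_like V s (Suc k) x y z (insert v (P - {a})) (insert v (Q - {b}))"
proof -
  have P: "P \<in> cliques V s" and Q: "Q \<in> cliques V s" and k: "card (P \<inter> Q) = k"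
    using wheel by (auto simp: wheel_like_def)
  have ab: "a \<in> P" "b \<in> Q" "a \<notin> Q" "b \<notin> P" using missed by (auto simp: non_nbrs_def)
  obtain s' where s: "s = Suc s'"
    using cliquesD[OF V P] ab(1) by (cases s) auto
  have "v \<in> common_nbrs V (P - {a})" "v \<in> common_nbrs V (Q - {b})"
    unfolding mem_common_nbrs_iff[OF v(1)] using missed by (auto simp: non_nbrs_def)
  then have "insert v (P - {a}) \<in> cliques V s" "insert v (Q - {b}) \<in> cliques V s"
    using P Q ab remove_cliques(1)[OF V] insert_cliques(1)[OF V] unfolding s by auto
  moreover have "card (insert v (P - {a}) \<inter> insert v (Q - {b})) = Suc k"
  proof -
    have "insert v (P - {a}) \<inter> insert v (Q - {b}) = insert v (P \<inter> Q)" using ab by auto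
    moreover have "v \<notin> P \<inter> Q" using missed(3) irrefl by (auto simp: non_nbrs_def)
    ultimately show ?thesis using cliquesD(1)[OF V P] k by simp
  qed
  ultimately show ?thesis
    using wheel v sym by (auto simp: wheel_like_def common_nbrs_def)
qed

lemma wheel_like_missed_ge:
  assumes V: "finite V" and free: "cliques V (s + 2) = {}" and wheel: "wheel_like V s k x y z P Q"
    and maximal: "\<And>P' Q'. \<not> wheel_like V s (Suc k) x y z P' Q'" and v: "v \<in> V"
  shows "3 \<le> card (non_nbrs P v) + card (non_nbrs Q v) + card (non_nbrs (P \<inter> Q) v) +
    card (non_nbrs {x} v) + card (non_nbrs {y} v) + card (non_nbrs {z} v)"
proof -
  have P: "P \<in> cliques V s" and Q: "Q \<in> cliques V s" using wheel by (auto simp: wheel_like_def)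
  have xyz: "x \<in> common_nbrs V P" "x \<in> common_nbrs V Q" "y \<in> common_nbrs V P" "z \<in> common_nbrs V Q"
    using wheel by (auto simp: wheel_like_def common_nbrs_def)
  have pos: "0 < card (non_nbrs R v)" if "non_nbrs R v \<noteq> {}" "R \<in> cliques V s" for R
    using that cliquesD(1)[OF V that(2)] by (simp add: card_gt_0_iff)
  have blocked: "card (non_nbrs {w} v) = 1"
    if "non_nbrs R v = {}" "R \<in> cliques V s" "w \<in> common_nbrs V R" for R w
    using not_adjacent_of_clique_free[OF V free that(2) _ that(3), of v]
      mem_common_nbrs_iff[OF v, of R] that(1)
    by (simp add: card_non_nbrs_singleton)
  consider (none_in_P) "non_nbrs P v = {}"
    | (none_in_Q) "non_nbrs P v \<noteq> {}" "non_nbrs Q v = {}"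
    | (some_in_Int) "non_nbrs P v \<noteq> {}" "non_nbrs Q v \<noteq> {}" "non_nbrs (P \<inter> Q) v \<noteq> {}"
    | (none_in_Int) "non_nbrs P v \<noteq> {}" "non_nbrs Q v \<noteq> {}" "non_nbrs (P \<inter> Q) v = {}"
    by blast
  then show ?thesis
  proof cases
    case none_in_P
    then have "card (non_nbrs {x} v) = 1" "card (non_nbrs {y} v) = 1" using blocked P xyz by blast+
    moreover have "0 < card (non_nbrs Q v) \<or> card (non_nbrs {z} v) = 1"
      using blocked pos Q xyz by blast
    ultimately show ?thesis by linarith
  next
    case none_in_Q
    then have "card (non_nbrs {x} v) = 1" "card (non_nbrs {z} v) = 1" using blocked Q xyz by blast+
    then show ?thesis using pos[OF none_in_Q(1) P] by linarith
  next
    case some_in_Int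
    then have "0 < card (non_nbrs (P \<inter> Q) v)"
      using cliquesD(1)[OF V P] by (simp add: card_gt_0_iff)
    then show ?thesis using pos[OF some_in_Int(1) P] pos[OF some_in_Int(2) Q] by linarith
  next
    case none_in_Int
    show ?thesis
    proof (rule ccontr)
      assume less: "\<not> ?thesis"
      have "card (non_nbrs P v) = 1" "card (non_nbrs Q v) = 1"
        using less pos[OF none_in_Int(1) P] pos[OF none_in_Int(2) Q] by linarith+
      then obtain a b where "non_nbrs P v = {a}" "non_nbrs Q v = {b}"
        by (auto simp: card_1_singleton_iff)
      moreover have "E v x" "E v y" "E v z"
        using less pos[OF none_in_Int(1) P] pos[OF none_in_Int(2) Q]
        by (auto simp: card_non_nbrs_singleton split: if_splits)
      ultimately show False using wheel_like_swap[OF V wheel v] none_in_Int(3) maximal by blast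
    qed
  qed
qed

lemma sum_card_non_nbrs_swap:
  assumes "finite K" "finite W"
  shows "(\<Sum>w\<in>W. card (non_nbrs K w)) = (\<Sum>u\<in>K. card (non_nbrs W u))"
proof -
  have "\<forall>u\<in>K. card {w \<in> W. \<not> E w u} = card (non_nbrs W u)"
    by (simp add: non_nbrs_def adj_commute[of _ u for u])
  from sum_multicount_gen[OF assms(2,1) this] show ?thesis by (simp add: non_nbrs_def)
qed

lemma wheel_like_card_less:
  assumes "finite V" "cliques V (s + 2) = {}" "wheel_like V s k x y z P Q"
  shows "k < s"
proof (rule ccontr)
  have PQ: "P \<in> cliques V s" "Q \<in> cliques V s" "card (P \<inter> Q) = k"
    and yz: "y \<in> common_nbrs V P" "z \<in> common_nbrs V Q" "E y z"
    using assms(3) by (auto simp: wheel_like_def)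
  note P = cliquesD[OF assms(1) PQ(1)] and Q = cliquesD[OF assms(1) PQ(2)]
  assume "\<not> k < s"
  then have "card (P \<inter> Q) = s" using P Q PQ(3) card_mono[of P "P \<inter> Q"] by simp
  then have "P \<inter> Q = P" "P \<inter> Q = Q"
    using P Q card_subset_eq[of P "P \<inter> Q"] card_subset_eq[of Q "P \<inter> Q"] by auto
  then show False
    using not_adjacent_of_clique_free[OF assms(1,2) PQ(1) yz(1), of z] yz by auto
qed

lemma wheel_like_extend:
  assumes V: "finite V" and free: "cliques V (s + 2) = {}"
    and g: "\<And>u. u \<in> V \<Longrightarrow> real (card (non_nbrs V u)) \<le> g" "(3 * real s + 2) * g < 3 * real (card V)"
    and wheel: "wheel_like V s k x y z P Q"
  shows "\<exists>P' Q'. wheel_like V s (Suc k) x y z P' Q'"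
proof (rule ccontr)
  assume "\<not> ?thesis"
  then have maximal: "\<And>P' Q'. \<not> wheel_like V s (Suc k) x y z P' Q'" by blast
  have PQ: "P \<in> cliques V s" "Q \<in> cliques V s" "card (P \<inter> Q) = k" and xyz: "x \<in> V" "y \<in> V" "z \<in> V"
    using wheel by (auto simp: wheel_like_def common_nbrs_def)
  note P = cliquesD[OF V PQ(1)] and Q = cliquesD[OF V PQ(2)]
  let ?d = "\<lambda>u. real (card (non_nbrs V u))"
  have g0: "0 \<le> g" using g(1)[OF xyz(1)] by linarith
  have sum_le: "(\<Sum>u\<in>R. ?d u) \<le> real (card R) * g" if "R \<subseteq> V" for R
    using sum_bounded_above[of R ?d g] g(1) that by auto
  have "3 * card V = (\<Sum>v\<in>V. 3)" by simp
  also have "\<dots> \<le> (\<Sum>v\<in>V. card (non_nbrs P v) + card (non_nbrs Q v) + card (non_nbrs (P \<inter> Q) v) +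
      card (non_nbrs {x} v) + card (non_nbrs {y} v) + card (non_nbrs {z} v))"
    by (rule sum_mono[OF wheel_like_missed_ge[OF V free wheel maximal]])
  finally have "3 * real (card V) \<le>
      (\<Sum>u\<in>P. ?d u) + (\<Sum>u\<in>Q. ?d u) + (\<Sum>u\<in>P \<inter> Q. ?d u) + ?d x + ?d y + ?d z"
    using P(1) Q(1) V by (simp add: sum.distrib sum_card_non_nbrs_swap flip: of_nat_sum)
  also have "\<dots> \<le> real s * g + real s * g + real k * g + g + g + g"
    using P Q PQ(3) xyz sum_le[of P] sum_le[of Q] sum_le[of "P \<inter> Q"] by (intro add_mono g(1)) auto
  also have "\<dots> = (2 * real s + real k + 3) * g" by (simp add: algebra_simps)
  also have "\<dots> \<le> (3 * real s + 2) * g"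
    using wheel_like_card_less[OF V free wheel] g0 by (intro mult_right_mono) auto
  finally show False using g(2) by linarith
qed

lemma not_wheel_like:
  assumes V: "finite V" and free: "cliques V (s + 2) = {}"
    and g: "\<And>u. u \<in> V \<Longrightarrow> real (card (non_nbrs V u)) \<le> g" "(3 * real s + 2) * g < 3 * real (card V)"
  shows "\<not> wheel_like V s k x y z P Q"
proof
  assume wheel: "wheel_like V s k x y z P Q"
  have "\<exists>P' Q'. wheel_like V s (k + i) x y z P' Q'" for i
  proof (induction i)
    case 0
    then show ?case using wheel by auto
  next
    case (Suc i)
    then show ?case using wheel_like_extend[OF V free g] by auto
  qed
  then obtain P' Q' where "wheel_like V s (k + s) x y z P' Q'" by blast
  then show False using wheel_like_card_less[OF V free] by fastforce
qed

lemma nonadjacency_trans_of_saturated: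
  assumes V: "finite V" and free: "cliques V (s + 2) = {}" and saturated: "saturated V s"
    and g: "\<And>u. u \<in> V \<Longrightarrow> real (card (non_nbrs V u)) \<le> g" "(3 * real s + 2) * g < 3 * real (card V)"
    and x: "x \<in> V" and y: "y \<in> V" "\<not> E x y" and z: "z \<in> V" "\<not> E x z"
  shows "\<not> E y z"
proof
  assume yz: "E y z"
  then have "x \<noteq> y" "x \<noteq> z" using y z sym by auto
  then obtain P Q where "P \<in> cliques V s" "P \<subseteq> common_nbrs V {x, y}"
    and "Q \<in> cliques V s" "Q \<subseteq> common_nbrs V {x, z}"
    using saturated x y z unfolding saturated_def by meson
  then have "wheel_like V s (card (P \<inter> Q)) x y z P Q"
    using x y(1) z(1) yz sym by (auto simp: wheel_like_def common_nbrs_def)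
  then show False using not_wheel_like[OF V free g] by blast
qed

lemma ex_proper_colouring_of_nonadjacency_trans:
  assumes V: "finite V" and free: "cliques V (Suc r) = {}"
    and trans: "\<And>x y z. x \<in> V \<Longrightarrow> y \<in> V \<Longrightarrow> z \<in> V \<Longrightarrow> \<not> E x y \<Longrightarrow> \<not> E x z \<Longrightarrow> \<not> E y z"
  shows "\<exists>c. proper_colouring V r c"
proof -
  obtain k where k: "k < Suc r" "\<forall>i\<le>k. cliques V i \<noteq> {}" "cliques V (Suc k) = {}"
    using ex_least_nat_less[of "\<lambda>k. cliques V k = {}" "Suc r"] free cliques_0[OF V] by auto
  then obtain Q where Q: "Q \<in> cliques V k" by auto
  note cQ = cliquesD[OF V Q]
  have "common_nbrs V Q = {}" using insert_cliques(1)[OF V Q] k(3) by auto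
  then have "\<forall>v\<in>V. \<exists>q\<in>Q. \<not> E q v" by (auto simp: common_nbrs_def)
  then obtain \<phi> where \<phi>: "\<And>v. v \<in> V \<Longrightarrow> \<phi> v \<in> Q \<and> \<not> E (\<phi> v) v" by metis
  obtain h :: "'a \<Rightarrow> nat" where h: "bij_betw h Q {0..<card Q}"
    using ex_bij_betw_finite_nat[OF cQ(1)] by auto
  have "proper_colouring V r (h \<circ> \<phi>)"
    unfolding proper_colouring_def
  proof (intro conjI ballI impI)
    fix u assume "u \<in> V"
    then show "(h \<circ> \<phi>) u < r" using \<phi> bij_betwE[OF h] cQ(3) k(1) by fastforce
  next
    fix u v assume uv: "u \<in> V" "v \<in> V" "E u v"
    have "\<phi> u \<noteq> \<phi> v" using \<phi>[OF uv(1)] \<phi>[OF uv(2)] trans[of "\<phi> u" u v] uv cQ(2) by auto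
    then show "(h \<circ> \<phi>) u \<noteq> (h \<circ> \<phi>) v"
      using \<phi> uv bij_betw_imp_inj_on[OF h] by (auto dest: inj_onD)
  qed
  then show ?thesis by blast
qed

lemma clique_free_insert_edge:
  assumes "cliques V (s + 2) = {}" "x \<noteq> y"
    and unsaturated: "\<not> (\<exists>P\<in>cliques V s. P \<subseteq> common_nbrs V {x, y})"
  defines "F \<equiv> \<lambda>u v. E u v \<or> {u, v} = {x, y}"
  shows "simple_adjacency F" "finite V \<Longrightarrow> simple_adjacency.cliques F V (s + 2) = {}"
proof -
  show F: "simple_adjacency F"
    by unfold_locales (use assms(2) sym irrefl in \<open>auto simp: F_def\<close>)
  assume V: "finite V"
  interpret F: simple_adjacency F by (rule F)
  show "F.cliques V (s + 2) = {}"
  proof (rule equals0I)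
    fix K assume K: "K \<in> F.cliques V (s + 2)"
    note clique = F.cliquesD[OF V K]
    show False
    proof (cases "{x, y} \<subseteq> K")
      case True
      then have "card (K - {x, y}) = s" using clique assms(2) by (simp add: card_Diff_subset)
      moreover have "E u v" if "u \<in> K" "v \<in> K - {x, y}" "u \<noteq> v" for u v
        using that clique(4) by (auto simp: pairwise_def F_def doubleton_eq_iff)
      ultimately have "K - {x, y} \<in> cliques V s" "K - {x, y} \<subseteq> common_nbrs V {x, y}"
        using True clique(2) by (auto simp: cliques_def common_nbrs_def pairwise_def)
      then show False using unsaturated by blast
    next
      case False
      then have "{u, v} \<noteq> {x, y}" if "u \<in> K" "v \<in> K" for u v using that by auto
      then have "K \<in> cliques V (s + 2)" using clique by (simp add: cliques_def pairwise_def F_def)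
      then show False using assms(1) by simp
    qed
  qed
qed

lemma ex_saturated_supergraph:
  assumes V: "finite V" and free: "cliques V (s + 2) = {}"
  shows "\<exists>F. simple_adjacency F \<and> E \<le> F \<and> simple_adjacency.cliques F V (s + 2) = {} \<and>
    simple_adjacency.saturated F V s"
proof -
  define edges where "edges F = {(u, v) \<in> V \<times> V. F u v}" for F
  define admissible where "admissible F \<longleftrightarrow>
    simple_adjacency F \<and> E \<le> F \<and> simple_adjacency.cliques F V (s + 2) = {}" for F
  have finite: "finite (edges F)" for F
    unfolding edges_def by (rule finite_subset[of _ "V \<times> V"]) (use V in auto)
  have "admissible E" using free simple_adjacency_axioms by (simp add: admissible_def)
  moreover have "\<forall>F. admissible F \<longrightarrow> card (edges F) < Suc (card (V \<times> V))"
    unfolding edges_def less_Suc_eq_le using V by (intro allI impI card_mono) auto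
  ultimately have "\<exists>F. admissible F \<and> (\<forall>F'. admissible F' \<longrightarrow> card (edges F') \<le> card (edges F))"
    by (rule ex_has_greatest_nat)
  then obtain F where F: "admissible F"
    and max: "\<forall>F'. admissible F' \<longrightarrow> card (edges F') \<le> card (edges F)"
    by (elim exE conjE)
  note F = F[unfolded admissible_def]
  interpret F: simple_adjacency F using F by blast
  have "F.saturated V s"
  proof (rule ccontr)
    assume "\<not> F.saturated V s"
    then obtain x y where xy: "x \<in> V" "y \<in> V" "x \<noteq> y" "\<not> F x y"
      and unsaturated: "\<not> (\<exists>P\<in>F.cliques V s. P \<subseteq> F.common_nbrs V {x, y})"
      unfolding F.saturated_def by blast
    let ?F' = "\<lambda>u v. F u v \<or> {u, v} = {x, y}"
    have "admissible ?F'"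
      using F F.clique_free_insert_edge[OF _ xy(3) unsaturated] V by (auto simp: admissible_def)
    then have "card (edges ?F') \<le> card (edges F)" using max by simp
    moreover have "edges F \<subset> edges ?F'" using xy by (auto simp: edges_def)
    ultimately show False using psubset_card_mono[OF finite] linorder_not_less by blast
  qed
  then show ?thesis using F by blast
qed

theorem andrasfai_erdos_sos:
  assumes V: "finite V" and r: "r \<ge> 1" and free: "cliques V (Suc r) = {}"
    and g: "\<And>u. u \<in> V \<Longrightarrow> real (card (non_nbrs V u)) \<le> g" "(3 * real r - 1) * g < 3 * real (card V)"
  shows "\<exists>c. proper_colouring V r c"
proof -
  obtain s where s: "r = Suc s" using r by (cases r) auto
  obtain F where "simple_adjacency F" and EF: "E \<le> F"
    and free: "simple_adjacency.cliques F V (s + 2) = {}"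
    and saturated: "simple_adjacency.saturated F V s"
    using ex_saturated_supergraph[OF V, of s] free s by auto
  then interpret F: simple_adjacency F by simp
  have "card (F.non_nbrs V u) \<le> card (non_nbrs V u)" for u
    using V EF by (intro card_mono) (auto simp: non_nbrs_def F.non_nbrs_def)
  then have gF: "real (card (F.non_nbrs V u)) \<le> g" if "u \<in> V" for u
    using g(1)[OF that] by (meson of_nat_le_iff order_trans)
  have "\<exists>c. F.proper_colouring V r c"
  proof (rule F.ex_proper_colouring_of_nonadjacency_trans[OF V])
    show "F.cliques V (Suc r) = {}" using free s by simp
    have "(3 * real s + 2) * g < 3 * real (card V)" using g(2) s by (simp add: add.commute)
    note trans = F.nonadjacency_trans_of_saturated[OF V free saturated gF this]
    show "\<not> F y z" if "x \<in> V" "y \<in> V" "z \<in> V" "\<not> F x y" "\<not> F x z" for x y z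
      by (rule trans[OF _ that(1,2,4,3,5)])
  qed
  then show ?thesis
    using predicate2D[OF EF] unfolding proper_colouring_def F.proper_colouring_def by blast
qed

section \<open>The largest eigenvalue\<close>

definition sq_norm :: "'a set \<Rightarrow> ('a \<Rightarrow> real) \<Rightarrow> real" where
  "sq_norm V x = (\<Sum>v\<in>V. (x v)\<^sup>2)"

definition top_eigenvalue :: "'a set \<Rightarrow> real" where
  "top_eigenvalue V = (SUP x\<in>{x. sq_norm V x = 1}. adj_form V x)"

definition perron :: "'a set \<Rightarrow> ('a \<Rightarrow> real) \<Rightarrow> bool" where
  "perron V x \<longleftrightarrow> (\<forall>v\<in>V. 0 \<le> x v) \<and> sq_norm V x = 1 \<and> adj_form V x = top_eigenvalue V"

lemma sq_norm_nonneg: "0 \<le> sq_norm V x"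
  by (simp add: sq_norm_def sum_nonneg)

lemma sq_norm_remove: "finite V \<Longrightarrow> w \<in> V \<Longrightarrow> sq_norm V x = (x w)\<^sup>2 + sq_norm (V - {w}) x"
  by (simp add: sq_norm_def sum.remove)

lemma sq_norm_scale: "sq_norm V (\<lambda>v. x v / c) = sq_norm V x / c\<^sup>2"
  by (simp add: sq_norm_def power_divide sum_divide_distrib)

lemma square_le_sq_norm: "finite V \<Longrightarrow> v \<in> V \<Longrightarrow> (x v)\<^sup>2 \<le> sq_norm V x"
  unfolding sq_norm_def by (intro member_le_sum) auto

lemma adj_form_scale: "adj_form V (\<lambda>v. x v / c) = adj_form V x / c\<^sup>2"
  by (simp add: adj_form_def sum_divide_distrib power2_eq_square)

lemma adj_form_cong: "(\<And>v. v \<in> V \<Longrightarrow> x v = z v) \<Longrightarrow> adj_form V x = adj_form V z"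
  unfolding adj_form_def by (intro sum.cong refl) (auto simp: nbrs_def)

lemma adj_form_le_abs: "adj_form V x \<le> adj_form V (\<lambda>v. \<bar>x v\<bar>)"
  unfolding adj_form_def by (intro sum_mono) (simp flip: abs_mult)

lemma adj_form_alt: "adj_form V x = (\<Sum>u\<in>V. x u * (\<Sum>v\<in>nbrs V u. x v))"
  by (simp add: adj_form_def sum_distrib_left)

lemma adj_form_remove:
  assumes "finite V" "w \<in> V"
  shows "adj_form V x = adj_form (V - {w}) x + 2 * x w * (\<Sum>v\<in>nbrs V w. x v)"
proof -
  have nbrs_sum: "(\<Sum>v\<in>nbrs V u. x v) =
      (if E u w then x w else 0) + (\<Sum>v\<in>nbrs (V - {w}) u. x v)" for u
  proof -
    have "nbrs V u = (if E u w then insert w (nbrs (V - {w}) u) else nbrs (V - {w}) u)"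
      using assms(2) by (auto simp: nbrs_def)
    then show ?thesis using assms(1) by (auto simp: nbrs_def)
  qed
  have "adj_form V x = x w * (\<Sum>v\<in>nbrs V w. x v) + (\<Sum>u\<in>V - {w}. x u * (\<Sum>v\<in>nbrs V u. x v))"
    unfolding adj_form_alt by (rule sum.remove[OF assms])
  also have "(\<Sum>u\<in>V - {w}. x u * (\<Sum>v\<in>nbrs V u. x v)) =
      (\<Sum>u\<in>V - {w}. if E w u then x w * x u else 0) + adj_form (V - {w}) x"
    unfolding adj_form_alt sum.distrib[symmetric]
    by (intro sum.cong refl) (simp add: nbrs_sum distrib_left mult.commute adj_commute[of _ w])
  also have "(\<Sum>u\<in>V - {w}. if E w u then x w * x u else 0) = x w * (\<Sum>v\<in>nbrs V w. x v)"
  proof -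
    have nbrs: "nbrs V w = {u \<in> V - {w}. E w u}" using irrefl by (auto simp: nbrs_def)
    show ?thesis
      unfolding nbrs sum_distrib_left using assms(1) by (intro sum.inter_filter[symmetric]) auto
  qed
  finally show ?thesis by simp
qed

lemma ex_adj_form_maximizer:
  assumes V: "finite V" "V \<noteq> {}"
  shows "\<exists>x. sq_norm V x = 1 \<and> (\<forall>z. sq_norm V z = 1 \<longrightarrow> adj_form V z \<le> adj_form V x)"
proof -
  define B where "B v = (if v \<in> V then {-1..1::real} else {0})" for v
  define S where "S = PiE UNIV B \<inter> {x. sq_norm V x = 1}"
  have cont: "continuous_on T (\<lambda>x :: 'a \<Rightarrow> real. x v)" for T v
    by (rule continuous_on_subset[OF continuous_on_product_coordinates]) simp
  have "compactin (product_topology (\<lambda>i. euclidean) UNIV) (PiE UNIV B)"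
    by (subst compactin_PiE) (auto simp: B_def)
  then have "compact (PiE UNIV B)" by (simp add: euclidean_product_topology)
  moreover have "closed {x. sq_norm V x = 1}"
    unfolding sq_norm_def by (intro closed_Collect_eq continuous_intros cont)
  ultimately have S: "compact S" unfolding S_def by (rule compact_Int_closed)
  have restrict_S: "(\<lambda>v. if v \<in> V then z v else 0) \<in> S" if "sq_norm V z = 1" for z
  proof -
    have "\<bar>z v\<bar> \<le> 1" if "v \<in> V" for v
      using square_le_sq_norm[OF V(1) that, of z] \<open>sq_norm V z = 1\<close> by (simp add: abs_square_le_1)
    then show ?thesis using that by (auto simp: S_def B_def sq_norm_def abs_le_iff)
  qed
  obtain v0 where v0: "v0 \<in> V" using V by auto
  have "sq_norm V (\<lambda>v. if v = v0 then 1 else 0) = 1"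
    using v0 V(1) by (simp add: sq_norm_def if_distrib[where f = "\<lambda>t. t\<^sup>2"] cong: if_cong)
  then have "S \<noteq> {}" using restrict_S by blast
  moreover have "continuous_on S (adj_form V)"
    unfolding adj_form_def by (intro continuous_intros cont)
  ultimately obtain x where x: "x \<in> S" "\<And>z. z \<in> S \<Longrightarrow> adj_form V z \<le> adj_form V x"
    using continuous_attains_sup[OF S] by blast
  have "adj_form V z \<le> adj_form V x" if "sq_norm V z = 1" for z
    using x(2)[OF restrict_S[OF that]] adj_form_cong[of V z "\<lambda>v. if v \<in> V then z v else 0"] by simp
  then show ?thesis using x(1) by (auto simp: S_def)
qed

lemma
  assumes V: "finite V" "V \<noteq> {}"
  shows ex_perron: "\<exists>x. perron V x"
    and adj_form_le_top_of_unit: "sq_norm V z = 1 \<Longrightarrow> adj_form V z \<le> top_eigenvalue V"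
proof -
  obtain x where x: "sq_norm V x = 1" and max: "\<And>z. sq_norm V z = 1 \<Longrightarrow> adj_form V z \<le> adj_form V x"
    using ex_adj_form_maximizer[OF V] by blast
  have top: "top_eigenvalue V = adj_form V x"
    unfolding top_eigenvalue_def by (intro cSup_eq_maximum) (use x max in auto)
  then show "sq_norm V z = 1 \<Longrightarrow> adj_form V z \<le> top_eigenvalue V" using max by simp
  have unit_abs: "sq_norm V (\<lambda>v. \<bar>x v\<bar>) = 1" using x by (simp add: sq_norm_def)
  have "perron V (\<lambda>v. \<bar>x v\<bar>)"
    using max[OF unit_abs] adj_form_le_abs[of V x] unit_abs top by (simp add: perron_def)
  then show "\<exists>x. perron V x" by blast
qed

lemma adj_form_le_top:
  assumes V: "finite V"
  shows "adj_form V z \<le> top_eigenvalue V * sq_norm V z"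
proof (cases "sq_norm V z = 0")
  case True
  then have "\<forall>v\<in>V. z v = 0" using V by (simp add: sq_norm_def sum_nonneg_eq_0_iff)
  then have "adj_form V z = 0" by (simp add: adj_form_def)
  then show ?thesis using True by simp
next
  case False
  then have pos: "sq_norm V z > 0" using sq_norm_nonneg[of V z] by simp
  then have "sq_norm V (\<lambda>v. z v / sqrt (sq_norm V z)) = 1" by (simp add: sq_norm_scale)
  moreover have "V \<noteq> {}" using False by (auto simp: sq_norm_def)
  ultimately have "adj_form V z / sq_norm V z \<le> top_eigenvalue V"
    using adj_form_le_top_of_unit[OF V, of "\<lambda>v. z v / sqrt (sq_norm V z)"] pos
    by (simp add: adj_form_scale)
  then show ?thesis using pos by (simp add: pos_divide_le_eq)
qed

lemma perron_eigenvector: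
  assumes V: "finite V" and x: "perron V x" and w: "w \<in> V"
  shows "(\<Sum>v\<in>nbrs V w. x v) = top_eigenvalue V * x w"
proof -
  define \<mu> where "\<mu> = top_eigenvalue V"
  have "t * (2 * ((\<Sum>v\<in>nbrs V w. x v) - \<mu> * x w)) \<le> \<mu> * t\<^sup>2" for t
  proof -
    let ?z = "x(w := x w + t)"
    have "(\<Sum>v\<in>nbrs V w. ?z v) = (\<Sum>v\<in>nbrs V w. x v)"
      using irrefl by (intro sum.cong refl) (auto simp: nbrs_def)
    moreover have "adj_form (V - {w}) ?z = adj_form (V - {w}) x" by (rule adj_form_cong) auto
    ultimately have "adj_form V ?z = \<mu> + 2 * t * (\<Sum>v\<in>nbrs V w. x v)"
      using adj_form_remove[OF V w, of ?z] adj_form_remove[OF V w, of x] x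
      by (simp add: \<mu>_def perron_def algebra_simps)
    moreover have "sq_norm (V - {w}) ?z = sq_norm (V - {w}) x"
      unfolding sq_norm_def by (intro sum.cong) auto
    then have "sq_norm V ?z = 1 + 2 * t * x w + t\<^sup>2"
      using sq_norm_remove[OF V w, of ?z] sq_norm_remove[OF V w, of x] x
      by (simp add: perron_def power2_sum)
    ultimately show ?thesis using adj_form_le_top[OF V, of ?z] by (simp add: \<mu>_def algebra_simps)
  qed
  then have "2 * ((\<Sum>v\<in>nbrs V w. x v) - \<mu> * x w) = 0" by (rule linear_le_square_imp_zero)
  then show ?thesis by (simp add: \<mu>_def)
qed

lemma top_eigenvalue_squared_le:
  assumes V: "finite V" and x: "perron V x"
  shows "(top_eigenvalue V)\<^sup>2 \<le> real (degree_sum V) * adj_form V (\<lambda>v. (x v)\<^sup>2)"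
proof -
  let ?P = "SIGMA u:V. nbrs V u"
  have "top_eigenvalue V = (\<Sum>p\<in>?P. 1 * (x (fst p) * x (snd p)))"
    using V x unfolding perron_def adj_form_def by (auto simp: sum.Sigma case_prod_unfold)
  then have "(top_eigenvalue V)\<^sup>2 \<le> (\<Sum>p\<in>?P. 1\<^sup>2) * (\<Sum>p\<in>?P. (x (fst p) * x (snd p))\<^sup>2)"
    by (simp only:) (rule Cauchy_Schwarz_ineq_sum)
  also have "(\<Sum>p\<in>?P. 1\<^sup>2) = real (degree_sum V)"
    using V by (simp add: degree_sum_def degree_def)
  also have "(\<Sum>p\<in>?P. (x (fst p) * x (snd p))\<^sup>2) = adj_form V (\<lambda>v. (x v)\<^sup>2)"
    unfolding adj_form_def using V by (simp add: sum.Sigma case_prod_unfold power_mult_distrib)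
  finally show ?thesis .
qed

lemma top_eigenvalue_squared_mult_entry_le:
  assumes V: "finite V" and x: "perron V x" and u: "u \<in> V"
  shows "(top_eigenvalue V)\<^sup>2 * (x u)\<^sup>2 \<le> real (degree V u) * (\<Sum>v\<in>nbrs V u. (x v)\<^sup>2)"
proof -
  have "(top_eigenvalue V)\<^sup>2 * (x u)\<^sup>2 = (\<Sum>v\<in>nbrs V u. 1 * x v)\<^sup>2"
    using perron_eigenvector[OF assms] by (simp add: power_mult_distrib)
  also have "\<dots> \<le> (\<Sum>v\<in>nbrs V u. 1\<^sup>2) * (\<Sum>v\<in>nbrs V u. (x v)\<^sup>2)" by (rule Cauchy_Schwarz_ineq_sum)
  finally show ?thesis by (simp add: degree_def)
qed

subsection \<open>The spectral form of Turan's theorem\<close>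

lemma perron_entry_squared_le:
  assumes V: "finite V" and x: "perron V x" and u: "u \<in> V"
    and half: "real (card V) / 2 \<le> top_eigenvalue V"
  shows "(x u)\<^sup>2 \<le> 4 / real (card V)"
proof -
  define m where "m = real (card V)"
  have m: "m > 0" using V u by (auto simp: m_def card_gt_0_iff)
  have "(m / 2)\<^sup>2 * (x u)\<^sup>2 \<le> (top_eigenvalue V)\<^sup>2 * (x u)\<^sup>2"
    using half by (intro mult_right_mono power_mono) (auto simp: m_def)
  also have "\<dots> \<le> real (degree V u) * (\<Sum>v\<in>nbrs V u. (x v)\<^sup>2)"
    by (rule top_eigenvalue_squared_mult_entry_le[OF V x u])
  also have "\<dots> \<le> m * sq_norm V x"
    unfolding sq_norm_def m_def using V degree_le_card[OF V]
    by (intro mult_mono sum_mono2 sum_nonneg nbrs_subset) auto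
  finally show ?thesis
    using m x by (simp add: perron_def m_def[symmetric] field_simps power2_eq_square)
qed

lemma adj_form_le_density:
  assumes V: "finite V" "V \<noteq> {}" and r: "r \<ge> 2"
    and \<gamma>: "0 \<le> \<gamma>" "edge_cliques_le V (Suc r) (\<gamma> * real (card V) ^ (r - 1))"
    and y: "\<And>v. v \<in> V \<Longrightarrow> 0 \<le> y v \<and> y v \<le> C / real (card V)" "sum y V = 1" "0 \<le> C"
  shows "adj_form V y \<le> 1 - 1 / real r + C ^ (r - 1) * \<gamma> * real r ^ (r - 2)"
proof -
  have "real (card V) > 0" using V by (simp add: card_gt_0_iff)
  then have scale: "(C / real (card V)) ^ (r - 1) * (\<gamma> * real (card V) ^ (r - 1)) = C ^ (r - 1) * \<gamma>"
    by (simp add: power_divide)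
  have "adj_form V y \<le>
      1 - 1 / real r +
      (C / real (card V)) ^ (r - 1) * (\<gamma> * real (card V) ^ (r - 1)) * real r ^ (r - 2)"
    using \<gamma>(1) y(3) by (intro motzkin_straus_edge_cliques[OF V(1) y(1,2) _ \<gamma>(2) r]) auto
  then show ?thesis unfolding scale .
qed

lemma degree_sum_le_density:
  assumes V: "finite V" "V \<noteq> {}" and r: "r \<ge> 2"
    and \<gamma>: "0 \<le> \<gamma>" "edge_cliques_le V (Suc r) (\<gamma> * real (card V) ^ (r - 1))"
  shows "real (degree_sum V) \<le> (1 - 1 / real r + \<gamma> * real r ^ (r - 2)) * (real (card V))\<^sup>2"
proof -
  have m: "real (card V) > 0" using V by (simp add: card_gt_0_iff)
  have "real (degree_sum V) / (real (card V))\<^sup>2 = adj_form V (\<lambda>_. 1 / real (card V))"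
    by (simp add: adj_form_const power_divide)
  also have "\<dots> \<le> 1 - 1 / real r + 1 ^ (r - 1) * \<gamma> * real r ^ (r - 2)"
    using m by (intro adj_form_le_density[OF V r \<gamma>]) auto
  finally show ?thesis using m by (simp add: pos_divide_le_eq)
qed

theorem top_eigenvalue_le_density:
  assumes V: "finite V" "V \<noteq> {}" and r: "r \<ge> 2"
    and \<gamma>: "0 \<le> \<gamma>" "edge_cliques_le V (Suc r) (\<gamma> * real (card V) ^ (r - 1))"
  shows "top_eigenvalue V \<le>
      (1 - 1 / real r + (1 + 4 ^ (r - 1)) / 2 * \<gamma> * real r ^ (r - 2)) * real (card V)"
proof (cases "real (card V) / 2 \<le> top_eigenvalue V")
  case True
  define m where "m = real (card V)"
  define A where "A = 1 - 1 / real r + \<gamma> * real r ^ (r - 2)"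
  define B where "B = 1 - 1 / real r + 4 ^ (r - 1) * \<gamma> * real r ^ (r - 2)"
  have m: "m \<ge> 0" by (simp add: m_def)
  have "0 \<le> 1 - 1 / real r" using r by simp
  then have AB: "0 \<le> A" "0 \<le> B" using \<gamma>(1) by (auto simp: A_def B_def)
  obtain x where x: "perron V x" using ex_perron[OF V] by blast
  have "adj_form V (\<lambda>v. (x v)\<^sup>2) \<le> B"
    unfolding B_def using x perron_entry_squared_le[OF V(1) x _ True]
    by (intro adj_form_le_density[OF V r \<gamma>]) (auto simp: perron_def sq_norm_def)
  then have "(top_eigenvalue V)\<^sup>2 \<le> real (degree_sum V) * B"
    using top_eigenvalue_squared_le[OF V(1) x] by (meson mult_left_mono of_nat_0_le_iff order_trans)
  also have "\<dots> \<le> A * m\<^sup>2 * B"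
    unfolding A_def m_def using AB by (intro mult_right_mono degree_sum_le_density[OF V r \<gamma>])
  also have "\<dots> = (A * m) * (B * m)" by (simp add: power2_eq_square)
  finally have "top_eigenvalue V \<le> sqrt ((A * m) * (B * m))" by (rule real_le_rsqrt)
  also have "\<dots> \<le> (A * m + B * m) / 2" using AB m by (intro arith_geo_mean_sqrt) auto
  also have "\<dots> = (1 - 1 / real r + (1 + 4 ^ (r - 1)) / 2 * \<gamma> * real r ^ (r - 2)) * m"
    by (simp add: A_def B_def field_simps)
  finally show ?thesis by (simp add: m_def)
next
  case False
  have "1 / 2 + 0 \<le> 1 - 1 / real r + (1 + 4 ^ (r - 1)) / 2 * \<gamma> * real r ^ (r - 2)"
    using r \<gamma>(1) by (intro add_mono) (auto simp: field_simps)
  then have "1 / 2 * real (card V) \<le>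
      (1 - 1 / real r + (1 + 4 ^ (r - 1)) / 2 * \<gamma> * real r ^ (r - 2)) * real (card V)"
    by (intro mult_right_mono) auto
  then show ?thesis using False by linarith
qed

lemma edge_cliques_le_of_clique_free: "cliques V s = {} \<Longrightarrow> edge_cliques_le V s 0"
  by (simp add: edge_cliques_le_def clique_extensions_def)

lemma top_eigenvalue_le_of_clique_free:
  assumes "finite V" "V \<noteq> {}" "r \<ge> 2" "cliques V (Suc r) = {}"
  shows "top_eigenvalue V \<le> (1 - 1 / real r) * real (card V)"
  using top_eigenvalue_le_density[OF assms(1-3), of 0] edge_cliques_le_of_clique_free[OF assms(4)]
  by simp

lemma top_eigenvalue_squared_le_of_clique_free:
  assumes V: "finite V" "V \<noteq> {}" and r: "r \<ge> 2" and free: "cliques V (Suc r) = {}"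
  shows "(top_eigenvalue V)\<^sup>2 \<le> real (degree_sum V) * (1 - 1 / real r)"
proof -
  obtain x where x: "perron V x" using ex_perron[OF V] by blast
  have "adj_form V (\<lambda>v. (x v)\<^sup>2) \<le> 1 - 1 / real r + 1 ^ (r - 1) * 0 * real r ^ (r - 2)"
    using x square_le_sq_norm[OF V(1), of _ x] edge_cliques_le_of_clique_free[OF free] r
    by (intro motzkin_straus_edge_cliques[OF V(1)]) (auto simp: perron_def sq_norm_def)
  then have "real (degree_sum V) * adj_form V (\<lambda>v. (x v)\<^sup>2) \<le>
      real (degree_sum V) * (1 - 1 / real r)"
    by (intro mult_left_mono) auto
  then show ?thesis using top_eigenvalue_squared_le[OF V(1) x] by linarith
qed

section \<open>Deleting vertices of small degree\<close>

lemma card_mult_min_entry_squared_le: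
  assumes "perron V x" "w \<in> V" "\<And>v. v \<in> V \<Longrightarrow> x w \<le> x v" "A \<subseteq> V"
  shows "real (card A) * (x w)\<^sup>2 \<le> (\<Sum>v\<in>A. (x v)\<^sup>2)"
proof -
  have "real (card A) * (x w)\<^sup>2 = (\<Sum>v\<in>A. (x w)\<^sup>2)" by simp
  also have "\<dots> \<le> (\<Sum>v\<in>A. (x v)\<^sup>2)"
    using assms by (intro sum_mono power_mono) (auto simp: perron_def)
  finally show ?thesis .
qed

lemma min_entry_squared_le:
  assumes V: "finite V" and x: "perron V x" and w: "w \<in> V" "\<And>v. v \<in> V \<Longrightarrow> x w \<le> x v"
    and u: "u \<in> V" "real (degree V u) \<le> d"
  shows "(x w)\<^sup>2 * ((top_eigenvalue V)\<^sup>2 + d * (real (card V) - d)) \<le> d"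
proof -
  define X where "X = (x w)\<^sup>2"
  define m where "m = real (card V)"
  define d' where "d' = real (degree V u)"
  have X: "0 \<le> X" "X \<le> (x u)\<^sup>2"
    using w u x by (auto simp: X_def perron_def intro: power_mono)
  have mX: "m * X \<le> 1"
    using card_mult_min_entry_squared_le[OF x w, of V] x
    by (simp add: m_def X_def perron_def sq_norm_def)
  have "m - d' = real (card (V - nbrs V u))"
    using V
    by (simp add: m_def d'_def degree_def card_Diff_subset nbrs_subset card_mono of_nat_diff)
  then have "(m - d') * X \<le> (\<Sum>v\<in>V - nbrs V u. (x v)\<^sup>2)"
    unfolding X_def using card_mult_min_entry_squared_le[OF x w] by simp
  then have nbrs: "(\<Sum>v\<in>nbrs V u. (x v)\<^sup>2) \<le> 1 - (m - d') * X"
    using sum.subset_diff[OF nbrs_subset V, of "\<lambda>v. (x v)\<^sup>2" u] x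
    by (simp add: perron_def sq_norm_def)
  have "(top_eigenvalue V)\<^sup>2 * X \<le> (top_eigenvalue V)\<^sup>2 * (x u)\<^sup>2"
    using X by (intro mult_left_mono) auto
  also have "\<dots> \<le> d' * (\<Sum>v\<in>nbrs V u. (x v)\<^sup>2)"
    unfolding d'_def by (rule top_eigenvalue_squared_mult_entry_le[OF V x u(1)])
  also have "\<dots> \<le> d' * (1 - (m - d') * X)"
    using nbrs by (intro mult_left_mono) (auto simp: d'_def)
  finally have "(top_eigenvalue V)\<^sup>2 * X \<le> d' * (1 - (m - d') * X)" .
  moreover have "0 \<le> (d - d') * (1 - m * X + X * (d + d'))"
    using mX u(2) X(1) by (intro mult_nonneg_nonneg add_nonneg_nonneg) (auto simp: d'_def)
  ultimately have "X * ((top_eigenvalue V)\<^sup>2 + d * (m - d)) \<le> d" by (simp add: algebra_simps)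
  then show ?thesis by (simp only: X_def m_def)
qed

lemma top_eigenvalue_remove_ge:
  assumes V: "finite V" and x: "perron V x" and w: "w \<in> V"
  shows "top_eigenvalue V * (1 - 2 * (x w)\<^sup>2) \<le> top_eigenvalue (V - {w}) * (1 - (x w)\<^sup>2)"
proof -
  have "adj_form (V - {w}) x = top_eigenvalue V * (1 - 2 * (x w)\<^sup>2)"
    using adj_form_remove[OF V w, of x] perron_eigenvector[OF V x w] x
    by (simp add: perron_def algebra_simps power2_eq_square)
  moreover have "sq_norm (V - {w}) x = 1 - (x w)\<^sup>2"
    using sq_norm_remove[OF V w, of x] x by (simp add: perron_def)
  ultimately show ?thesis using adj_form_le_top[of "V - {w}" x] V by simp
qed

lemma ex_deletion_gain:
  fixes a b e :: real
  assumes W: "finite W" and u: "u \<in> W" "real (degree W u) \<le> (a - e) * real (card W)"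
    and top: "(a - b) * real (card W) \<le> top_eigenvalue W"
    and e: "0 < e" "e \<le> 1 / 32" and b: "0 \<le> b" "b \<le> e / 20" and a: "1 / 2 \<le> a"
    and large: "4 \<le> real (card W) * e"
  shows "\<exists>w\<in>W. top_eigenvalue W / real (card W) + 2 / 3 * e / real (card W)
    \<le> top_eigenvalue (W - {w}) / (real (card W) - 1)"
proof -
  define m where "m = real (card W)"
  define l where "l = top_eigenvalue W"
  have W0: "W \<noteq> {}" using u by auto
  have "real (card W) * e \<le> real (card W) * (1 / 32)" using e by (intro mult_left_mono) auto
  then have m: "1 < m" using large by (simp add: m_def)
  obtain x where x: "perron W x" using ex_perron[OF W W0] by blast
  obtain w where w: "w \<in> W" "\<And>v. v \<in> W \<Longrightarrow> x w \<le> x v"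
    using arg_min_if_finite[OF W W0, of x] by (metis linorder_not_less)
  define X where "X = (x w)\<^sup>2"
  have F: "a - b \<le> l / m" using top m by (simp add: l_def m_def pos_le_divide_eq)
  have "m * X * ((l / m)\<^sup>2 + (a - e) * (1 - (a - e))) \<le> a - e"
  proof -
    have "m * (m * X * ((l / m)\<^sup>2 + (a - e) * (1 - (a - e)))) =
        X * (l\<^sup>2 + (a - e) * m * (m - (a - e) * m))"
      using m by (simp add: power2_eq_square divide_simps) (simp add: algebra_simps)
    also have "\<dots> \<le> m * (a - e)"
      using min_entry_squared_le[OF W x w u] by (simp add: X_def l_def m_def mult.commute)
    finally show ?thesis using m by simp
  qed
  then have y: "m * X \<le> 1 - 7 / 4 * e"
    using m by (intro scaled_min_entry_le[OF e b a F]) (auto simp: X_def)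
  have "m * X \<le> m * (e / 4)" using y e large by (simp add: m_def)
  also have "\<dots> \<le> m * (1 - m * X - 3 / 2 * e)" using y m by (intro mult_left_mono) auto
  finally have gap: "m * X \<le> m * (1 - m * X - 3 / 2 * e)" .
  have "7 / 15 \<le> l / m" using F a b e by linarith
  then have "7 / 15 * (3 / 2 * e / m) \<le> l / m * (3 / 2 * e / m)"
    using e m by (intro mult_right_mono) auto
  moreover have "2 / 3 * e / m \<le> 7 / 15 * (3 / 2 * e / m)" using e m by (simp add: field_simps)
  moreover have "l / m * (1 + 3 / 2 * e / m) \<le> top_eigenvalue (W - {w}) / (m - 1)"
  proof (rule deletion_ratio_ge[OF m _ _ _ gap])
    have "0 < l / m" using \<open>7 / 15 \<le> l / m\<close> by linarith
    then show "0 \<le> l" using m by (simp add: zero_less_divide_iff)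
    show "l * (1 - 2 * X) \<le> top_eigenvalue (W - {w}) * (1 - X)"
      unfolding l_def X_def by (rule top_eigenvalue_remove_ge[OF W x w(1)])
  qed (use e in \<open>auto simp: X_def\<close>)
  ultimately have "l / m + 2 / 3 * e / m \<le> top_eigenvalue (W - {w}) / (m - 1)"
    by (simp add: distrib_left)
  then show ?thesis using w(1) unfolding l_def m_def by blast
qed

definition gains_density :: "'a set \<Rightarrow> real \<Rightarrow> real \<Rightarrow> 'a set \<Rightarrow> bool" where
  "gains_density V c \<delta> W \<longleftrightarrow> W \<subseteq> V \<and>
     (c + \<delta> * ((real (card V) - real (card W)) / real (card V))) * real (card W) \<le> top_eigenvalue W"

lemma ex_gains_density_remove:
  fixes a b e :: real
  assumes V: "finite V" and W: "gains_density V (a - b) (2 / 3 * e) W" "card V \<le> 2 * card W"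
    and u: "u \<in> W" "real (degree W u) \<le> (a - e) * real (card W)"
    and e: "0 < e" "e \<le> 1 / 32" and b: "0 \<le> b" "b \<le> e / 20" and a: "1 / 2 \<le> a"
    and large: "8 \<le> real (card V) * e"
  shows "\<exists>w\<in>W. gains_density V (a - b) (2 / 3 * e) (W - {w})"
proof -
  define n where "n = real (card V)"
  define m where "m = real (card W)"
  have WV: "W \<subseteq> V" using W(1) by (simp add: gains_density_def)
  have finite: "finite W" using WV V finite_subset by auto
  have m: "n \<le> 2 * m" "m \<le> n" using W(2) V WV card_mono[of V W] by (auto simp: n_def m_def)
  have "n * e \<le> n * (1 / 32)" using e by (intro mult_left_mono) (auto simp: n_def)
  then have n: "256 \<le> n" using large by (simp add: n_def)
  then have m1: "1 < m" using m by linarith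
  have ratio: "a - b + 2 / 3 * e * ((n - m) / n) \<le> top_eigenvalue W / m"
    using W(1) m1 by (simp add: gains_density_def n_def m_def pos_le_divide_eq)
  have "0 \<le> 2 / 3 * e * ((n - m) / n)" using e m n by (intro mult_nonneg_nonneg) auto
  then have "a - b \<le> top_eigenvalue W / m" using ratio by linarith
  then have "(a - b) * m \<le> top_eigenvalue W" using m1 by (simp add: pos_le_divide_eq)
  moreover have "n * e \<le> 2 * m * e" using m e by (intro mult_right_mono) auto
  then have "4 \<le> m * e" using large[folded n_def] by linarith
  ultimately have "\<exists>w\<in>W. top_eigenvalue W / m + 2 / 3 * e / m \<le> top_eigenvalue (W - {w}) / (m - 1)"
    unfolding m_def by (intro ex_deletion_gain[OF finite u _ e b a]) auto
  then obtain w where w: "w \<in> W"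
    and gain: "top_eigenvalue W / m + 2 / 3 * e / m \<le> top_eigenvalue (W - {w}) / (m - 1)"
    by blast
  have "card W = Suc (card (W - {w}))" using card_Suc_Diff1[OF finite w] by simp
  then have card: "real (card (W - {w})) = m - 1" by (simp add: m_def)
  have "2 / 3 * e / n \<le> 2 / 3 * e / m" using m m1 e by (intro divide_left_mono) auto
  moreover have "2 / 3 * e * ((n - (m - 1)) / n) = 2 / 3 * e * ((n - m) / n) + 2 / 3 * e / n"
    using n by (simp add: field_simps)
  ultimately have "a - b + 2 / 3 * e * ((n - (m - 1)) / n) \<le> top_eigenvalue (W - {w}) / (m - 1)"
    using ratio gain by linarith
  then have "gains_density V (a - b) (2 / 3 * e) (W - {w})"
    using m1 WV unfolding gains_density_def card n_def[symmetric] by (auto simp: pos_le_divide_eq)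
  then show ?thesis using w by blast
qed

text \<open>In a smallest subset that has gained density, deleting one more vertex of small degree would
  leave less than half of the vertices; but then the density exceeds its upper bound.\<close>

lemma ex_gains_density_high_degree:
  fixes a b e :: real
  assumes V: "finite V" and e: "0 < e" "e \<le> 1 / 32" and b: "0 \<le> b" "b \<le> e / 100" and a: "1 / 2 \<le> a"
    and large: "8 \<le> real (card V) * e" and top: "(a - b) * real (card V) \<le> top_eigenvalue V"
    and bound: "\<And>W. W \<subseteq> V \<Longrightarrow> card V \<le> 2 * card W \<Longrightarrow>
      top_eigenvalue W \<le> (a + 5 / 16 * e) * real (card W)"
  shows "\<exists>W. gains_density V (a - b) (2 / 3 * e) W \<and> card V \<le> 2 * card W \<and>
    (\<forall>u\<in>W. (a - e) * real (card W) < real (degree W u))"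
proof -
  define n where "n = real (card V)"
  have "n * e \<le> n * (1 / 32)" using e by (intro mult_left_mono) (auto simp: n_def)
  then have n: "256 \<le> n" using large by (simp add: n_def)
  have "gains_density V (a - b) (2 / 3 * e) V \<and> card V \<le> 2 * card V"
    using top by (simp add: gains_density_def)
  then obtain W where W: "gains_density V (a - b) (2 / 3 * e) W" "card V \<le> 2 * card W"
    and min: "\<And>W'. gains_density V (a - b) (2 / 3 * e) W' \<Longrightarrow> card V \<le> 2 * card W' \<Longrightarrow> card W \<le> card W'"
    using ex_has_least_nat[of
        "\<lambda>W. gains_density V (a - b) (2 / 3 * e) W \<and> card V \<le> 2 * card W" V card]
    by blast
  define m where "m = real (card W)"
  have WV: "W \<subseteq> V" using W(1) by (simp add: gains_density_def)
  have m0: "0 < m" using W(2) n by (simp add: n_def m_def)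
  have "(a - e) * m < real (degree W u)" if u: "u \<in> W" for u
  proof (rule ccontr)
    assume "\<not> ?thesis"
    then obtain w where w: "w \<in> W" and gain: "gains_density V (a - b) (2 / 3 * e) (W - {w})"
      using ex_gains_density_remove[OF V W u _ e b(1) _ a large] b e by (auto simp: m_def)
    have "finite W" using WV V finite_subset by auto
    then have card: "card W = Suc (card (W - {w}))" using card_Suc_Diff1[OF _ w] by simp
    then have "\<not> card V \<le> 2 * card (W - {w})" using min[OF gain] by linarith
    then have "2 * m \<le> n + 1" using card by (simp add: m_def n_def)
    then have "49 / 100 \<le> (n - m) / n" using n by (simp add: field_simps)
    then have "2 / 3 * e * (49 / 100) \<le> 2 / 3 * e * ((n - m) / n)"
      using e by (intro mult_left_mono) auto
    then have "a + 5 / 16 * e < a - b + 2 / 3 * e * ((n - m) / n)" using b e by linarith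
    then have "(a + 5 / 16 * e) * m < (a - b + 2 / 3 * e * ((n - m) / n)) * m"
      using m0 by (rule mult_strict_right_mono)
    then show False using bound[OF WV W(2)] W(1) by (simp add: gains_density_def n_def m_def)
  qed
  then show ?thesis using W unfolding m_def by blast
qed

section \<open>Stability\<close>

definition missing_nbrs :: "'a set \<Rightarrow> ('a \<Rightarrow> nat) \<Rightarrow> 'a \<Rightarrow> 'a set" where
  "missing_nbrs W c u = {v \<in> W. c v \<noteq> c u \<and> \<not> E u v}"

lemma card_eq_class_degree_missing:
  assumes W: "finite W" and c: "proper_colouring W r c" and u: "u \<in> W"
  shows "card W = card {v \<in> W. c v = c u} + degree W u + card (missing_nbrs W c u)"
proof -
  have "W = ({v \<in> W. c v = c u} \<union> nbrs W u) \<union> missing_nbrs W c u"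
    by (auto simp: nbrs_def missing_nbrs_def)
  moreover have "{v \<in> W. c v = c u} \<inter> nbrs W u = {}"
    using c u by (fastforce simp: nbrs_def proper_colouring_def)
  moreover have "({v \<in> W. c v = c u} \<union> nbrs W u) \<inter> missing_nbrs W c u = {}"
    by (auto simp: nbrs_def missing_nbrs_def)
  ultimately show ?thesis
    unfolding degree_def using W by (metis (no_types, lifting) card_Un_disjoint finite_Un)
qed

lemma sum_class_variance_missing:
  assumes W: "finite W" and c: "proper_colouring W r c" and r: "r > 0"
  shows "(\<Sum>i<r. (real (card {v \<in> W. c v = i}) - real (card W) / real r)\<^sup>2)
      + (\<Sum>u\<in>W. real (card (missing_nbrs W c u)))
    = (1 - 1 / real r) * (real (card W))\<^sup>2 - real (degree_sum W)"
proof -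
  have "(real (card W))\<^sup>2 = (\<Sum>u\<in>W. real (card W))" by (simp add: power2_eq_square)
  also have "\<dots> =
      (\<Sum>u\<in>W. real (card {v \<in> W. c v = c u}) + real (degree W u) + real (card (missing_nbrs W c u)))"
    using card_eq_class_degree_missing[OF W c] by (intro sum.cong refl) (metis of_nat_add)
  also have "\<dots> =
      (\<Sum>u\<in>W. real (card {v \<in> W. c v = c u})) + real (degree_sum W)
      + (\<Sum>u\<in>W. real (card (missing_nbrs W c u)))"
    by (simp add: sum.distrib degree_sum_def)
  also have "(\<Sum>u\<in>W. real (card {v \<in> W. c v = c u})) = (real (card W))\<^sup>2 / real r +
      (\<Sum>i<r. (real (card {v \<in> W. c v = i}) - real (card W) / real r)\<^sup>2)"
    using c by (intro sum_card_colour_classes[OF W _ r]) (auto simp: proper_colouring_def)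
  finally show ?thesis by (simp add: left_diff_distrib)
qed

lemma card_colour_class_le:
  assumes W: "finite W" and c: "proper_colouring W r c" and i: "i < r" and \<delta>: "0 \<le> \<delta>"
    and dense: "(1 - 1 / real r - \<delta>\<^sup>2) * (real (card W))\<^sup>2 \<le> real (degree_sum W)"
  shows "real (card {v \<in> W. c v = i}) \<le> (1 / real r + \<delta>) * real (card W)"
proof -
  let ?dev = "\<lambda>i. real (card {v \<in> W. c v = i}) - real (card W) / real r"
  have "(?dev i)\<^sup>2 \<le> (\<Sum>i<r. (?dev i)\<^sup>2)"
    using i by (intro member_le_sum) auto
  also have "\<dots> \<le> (\<Sum>i<r. (?dev i)\<^sup>2) + (\<Sum>u\<in>W. real (card (missing_nbrs W c u)))"
    by (simp add: sum_nonneg)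
  also have "\<dots> \<le> (\<delta> * real (card W))\<^sup>2"
    using sum_class_variance_missing[OF W c] i dense by (simp add: power_mult_distrib algebra_simps)
  finally have "?dev i \<le> \<delta> * real (card W)" by (rule power2_le_imp_le) (use \<delta> in simp)
  then show ?thesis by (simp add: algebra_simps)
qed

lemma card_low_degree_le:
  assumes W: "finite W" and c: "proper_colouring W r c" and r: "r > 0" and \<delta>: "0 < \<delta>"
    and dense: "(1 - 1 / real r - \<delta>\<^sup>2) * (real (card W))\<^sup>2 \<le> real (degree_sum W)"
  shows "real (card {u \<in> W. real (degree W u) \<le> (1 - 1 / real r - 2 * \<delta>) * real (card W)}) \<le>
      \<delta> * real (card W)"
    (is "real (card ?L) \<le> _")
proof (cases "W = {}")
  case False
  define m where "m = real (card W)"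
  have m: "0 < m" using False W by (simp add: m_def card_gt_0_iff)
  let ?missing = "\<lambda>u. real (card (missing_nbrs W c u))"
  have "\<delta> * m \<le> ?missing u" if "u \<in> ?L" for u
  proof -
    have u: "u \<in> W" "real (degree W u) \<le> (1 - 1 / real r - 2 * \<delta>) * m"
      using that by (auto simp: m_def)
    have "real (card {v \<in> W. c v = c u}) \<le> (1 / real r + \<delta>) * m"
      using c u(1) \<delta> unfolding m_def
      by (intro card_colour_class_le[OF W c _ _ dense]) (auto simp: proper_colouring_def)
    moreover have "m = real (card {v \<in> W. c v = c u}) + real (degree W u) + ?missing u"
      unfolding m_def card_eq_class_degree_missing[OF W c u(1)] by simp
    moreover have "(1 / real r + \<delta>) * m + (1 - 1 / real r - 2 * \<delta>) * m = m - \<delta> * m"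
      by (simp add: algebra_simps)
    ultimately show ?thesis using u(2) by linarith
  qed
  then have "real (card ?L) * (\<delta> * m) \<le> (\<Sum>u\<in>?L. ?missing u)" by (rule sum_bounded_below)
  also have "\<dots> \<le> (\<Sum>u\<in>W. ?missing u)" using W by (intro sum_mono2) auto
  also have "\<dots> \<le> (\<Sum>i<r. (real (card {v \<in> W. c v = i}) - m / real r)\<^sup>2) + (\<Sum>u\<in>W. ?missing u)"
    by (simp add: sum_nonneg)
  also have "\<dots> \<le> (\<delta> * m) * (\<delta> * m)"
    using sum_class_variance_missing[OF W c r] dense
    by (simp add: m_def power2_eq_square algebra_simps)
  finally show ?thesis using \<delta> m by (simp add: m_def)
qed simp

lemma ex_subset_high_degree:
  assumes W: "finite W" and c: "proper_colouring W r c" and r: "r > 0" and \<delta>: "0 < \<delta>"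
    and dense: "(1 - 1 / real r - \<delta>\<^sup>2) * (real (card W))\<^sup>2 \<le> real (degree_sum W)"
  shows "\<exists>U\<subseteq>W. (1 - \<delta>) * real (card W) \<le> real (card U) \<and>
    (\<forall>u\<in>U. (1 - 1 / real r - 3 * \<delta>) * real (card W) < real (degree U u))"
proof -
  define L where "L = {u \<in> W. real (degree W u) \<le> (1 - 1 / real r - 2 * \<delta>) * real (card W)}"
  have L: "L \<subseteq> W" "finite L" "real (card L) \<le> \<delta> * real (card W)"
    using W card_low_degree_le[OF assms] by (auto simp: L_def)
  have "(1 - \<delta>) * real (card W) \<le> real (card (W - L))"
    using L W by (simp add: card_Diff_subset of_nat_diff card_mono left_diff_distrib)
  moreover have "(1 - 1 / real r - 3 * \<delta>) * real (card W) < real (degree (W - L) u)"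
    if u: "u \<in> W - L" for u
  proof -
    have "degree W u \<le> card (nbrs (W - L) u \<union> L)"
      unfolding degree_def using W L by (intro card_mono) (auto simp: nbrs_def)
    also have "\<dots> \<le> degree (W - L) u + card L" unfolding degree_def by (rule card_Un_le)
    finally have "real (degree W u) \<le> real (degree (W - L) u) + real (card L)" by linarith
    moreover have "(1 - 1 / real r - 2 * \<delta>) * real (card W) < real (degree W u)"
      using u by (auto simp: L_def)
    moreover have "(1 - 1 / real r - 3 * \<delta>) * real (card W) =
        (1 - 1 / real r - 2 * \<delta>) * real (card W) - \<delta> * real (card W)"
      by (simp add: algebra_simps)
    ultimately show ?thesis using L(3) by linarith
  qed
  ultimately show ?thesis by (intro exI[of _ "W - L"]) auto
qed

lemma edge_cliques_le_density:
  assumes "finite V" "W \<subseteq> V" "card V \<le> 2 * card W"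
    and "edge_cliques_le V (Suc r) (real (card V) ^ (r - 1) / real r ^ (2 * r + 5))"
  shows "edge_cliques_le W (Suc r) (2 ^ (r - 1) / real r ^ (2 * r + 5) * real (card W) ^ (r - 1))"
proof (rule edge_cliques_le_mono[OF assms(1,2,4)])
  have "real (card V) ^ (r - 1) \<le> (2 * real (card W)) ^ (r - 1)"
    using assms(3) by (intro power_mono) auto
  then show "real (card V) ^ (r - 1) / real r ^ (2 * r + 5) \<le>
      2 ^ (r - 1) / real r ^ (2 * r + 5) * real (card W) ^ (r - 1)"
    by (simp add: power_mult_distrib divide_right_mono)
qed

lemma ex_proper_colouring_of_edge_cliques_le:
  assumes W: "finite W" "W \<noteq> {}" and r: "r \<ge> 2"
    and J: "edge_cliques_le W (Suc r) (\<gamma> * real (card W) ^ (r - 1))"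
      "\<gamma> < 5 / (6 * real r ^ (r + 2))"
    and degree: "\<And>u. u \<in> W \<Longrightarrow> (1 - 1 / real r - 1 / (2 * real r ^ 4)) * real (card W) <
        real (degree W u)"
  shows "cliques W (Suc r) = {}" "\<exists>c. proper_colouring W r c"
proof -
  have non_nbrs: "real (card (non_nbrs W u)) \<le> (1 / real r + 1 / (2 * real r ^ 4)) * real (card W)"
    if "u \<in> W" for u
    using degree[OF that] by (simp add: real_degree[OF W(1)] algebra_simps)
  show free: "cliques W (Suc r) = {}"
    by (rule clique_free_of_edge_cliques_le[OF W(1) r J non_nbrs])
  have "real r * 4 \<le> real r * (real r)\<^sup>2"
    using r power_mono[of 2 "real r" 2] by (intro mult_left_mono) auto
  then have "3 * real r < 1 + 2 * real r ^ 3" by (simp add: power2_eq_square power3_eq_cube)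
  then have "(3 * real r - 1) * (1 / real r + 1 / (2 * real r ^ 4)) < 3"
    using r by (simp add: field_simps eval_nat_numeral)
  then have "(3 * real r - 1) * ((1 / real r + 1 / (2 * real r ^ 4)) * real (card W)) <
      3 * real (card W)"
    using W by (simp add: card_gt_0_iff flip: mult.assoc)
  then show "\<exists>c. proper_colouring W r c"
    using r by (intro andrasfai_erdos_sos[OF W(1) _ free non_nbrs]) auto
qed

lemma gains_density_clique_free:
  assumes V: "finite V" and W: "W \<noteq> {}" "cliques W (Suc r) = {}" and r: "r \<ge> 2"
    and gains: "gains_density V (1 - 1 / real r - b) \<delta> W" and \<delta>: "0 \<le> \<delta>" and b: "b \<le> 1 - 1 / real r"
  shows "\<delta> * (real (card V) - real (card W)) \<le> b * real (card V)"
    and "(1 - 1 / real r - 2 * b) * (real (card W))\<^sup>2 \<le> real (degree_sum W)"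
proof -
  define n where "n = real (card V)"
  define m where "m = real (card W)"
  define a where "a = 1 - 1 / real r"
  have WV: "W \<subseteq> V" using gains by (simp add: gains_density_def)
  have finite: "finite W" using WV V by (rule finite_subset)
  have m: "0 < m" "m \<le> n" using W WV V finite by (auto simp: m_def n_def card_gt_0_iff card_mono)
  have a: "0 < a" using r by (simp add: a_def)
  have gains: "(a - b + \<delta> * ((n - m) / n)) * m \<le> top_eigenvalue W"
    using gains by (simp add: gains_density_def n_def m_def a_def)
  also have "\<dots> \<le> a * m"
    unfolding a_def m_def by (rule top_eigenvalue_le_of_clique_free[OF finite W(1) r W(2)])
  finally have "\<delta> * ((n - m) / n) \<le> b" using m by simp
  then show "\<delta> * (real (card V) - real (card W)) \<le> b * real (card V)"
    using m by (simp add: field_simps flip: n_def m_def)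
  have "0 \<le> \<delta> * ((n - m) / n)" using \<delta> m by (intro mult_nonneg_nonneg) auto
  then have "(a - b) * m \<le> (a - b + \<delta> * ((n - m) / n)) * m" using m by (intro mult_right_mono) auto
  then have top: "(a - b) * m \<le> top_eigenvalue W" using gains by linarith
  have "((a - 2 * b) * m\<^sup>2) * a \<le> ((a - 2 * b) * m\<^sup>2) * a + (b * m)\<^sup>2" by simp
  also have "\<dots> = ((a - b) * m)\<^sup>2" by (simp add: algebra_simps power2_eq_square)
  also have "\<dots> \<le> (top_eigenvalue W)\<^sup>2" using top m b by (intro power_mono) (auto simp: a_def)
  also have "\<dots> \<le> real (degree_sum W) * a"
    unfolding a_def by (rule top_eigenvalue_squared_le_of_clique_free[OF finite W(1) r W(2)])
  finally have "(a - 2 * b) * m\<^sup>2 \<le> real (degree_sum W)" using a by simp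
  then show "(1 - 1 / real r - 2 * b) * (real (card W))\<^sup>2 \<le> real (degree_sum W)"
    by (simp only: a_def m_def)
qed

lemma ex_dense_multipartite_subset:
  assumes V: "finite V" and r: "r \<ge> 2" and b: "0 \<le> b" "b * real r ^ 4 \<le> 1 / 200"
    and n: "16 * real r ^ 4 \<le> real (card V)"
    and top: "(1 - 1 / real r - b) * real (card V) \<le> top_eigenvalue V"
    and J: "edge_cliques_le V (Suc r) (real (card V) ^ (r - 1) / real r ^ (2 * r + 5))"
  shows "\<exists>W c. W \<subseteq> V \<and> proper_colouring W r c \<and>
    real (card V) - real (card W) \<le> 3 * (b * real r ^ 4) * real (card V) \<and>
    (1 - 1 / real r - 2 * b) * (real (card W))\<^sup>2 \<le> real (degree_sum W)"
proof -
  define n where "n = real (card V)"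
  define a where "a = 1 - 1 / real r"
  define e where "e = 1 / (2 * real r ^ 4)"
  define \<gamma> where "\<gamma> = 2 ^ (r - 1) / real r ^ (2 * r + 5)"
  have r4: "16 \<le> real r ^ 4" using r power_mono[of 2 "real r" 4] by simp
  have a: "1 / 2 \<le> a" using r by (simp add: a_def field_simps)
  have e: "0 < e" "e \<le> 1 / 32" using r4 r by (auto simp: e_def field_simps)
  have b_le: "b \<le> e / 100" using b r by (simp add: e_def field_simps)
  have large: "8 \<le> n * e" using n r by (simp add: n_def e_def field_simps)
  have n0: "0 < n" using n r4 by (simp add: n_def)
  have nonempty: "W \<noteq> {}" if "card V \<le> 2 * card W" for W using that n0 by (auto simp: n_def)
  have density: "edge_cliques_le W (Suc r) (\<gamma> * real (card W) ^ (r - 1))"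
    if "W \<subseteq> V" "card V \<le> 2 * card W" for W
    unfolding \<gamma>_def by (rule edge_cliques_le_density[OF V that J])
  have "top_eigenvalue W \<le> (a + 5 / 16 * e) * real (card W)"
    if W: "W \<subseteq> V" "card V \<le> 2 * card W" for W
  proof -
    have "top_eigenvalue W \<le> (a + (1 + 4 ^ (r - 1)) / 2 * \<gamma> * real r ^ (r - 2)) * real (card W)"
      unfolding a_def using finite_subset[OF W(1) V] nonempty[OF W(2)] density[OF W]
      by (intro top_eigenvalue_le_density[OF _ _ r]) (auto simp: \<gamma>_def)
    also have "\<dots> \<le> (a + 5 / 16 * e) * real (card W)"
      using spectral_excess_le[OF r]
      unfolding \<gamma>_def e_def by (intro mult_right_mono add_left_mono) auto
    finally show ?thesis .
  qed
  then obtain W where gains: "gains_density V (a - b) (2 / 3 * e) W" and half: "card V \<le> 2 * card W"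
    and degree: "\<forall>u\<in>W. (a - e) * real (card W) < real (degree W u)"
    using ex_gains_density_high_degree[OF V e b(1) b_le a large[unfolded n_def]] top
    unfolding a_def by blast
  have WV: "W \<subseteq> V" using gains by (simp add: gains_density_def)
  note W = finite_subset[OF WV V] nonempty[OF half]
  have \<gamma>: "\<gamma> < 5 / (6 * real r ^ (r + 2))" unfolding \<gamma>_def by (rule clique_density_less[OF r])
  have free: "cliques W (Suc r) = {}" and "\<exists>c. proper_colouring W r c"
    using ex_proper_colouring_of_edge_cliques_le[OF W r density[OF WV half] \<gamma>] degree
    by (auto simp: a_def e_def)
  then obtain c where c: "proper_colouring W r c" by blast
  have "b \<le> a" using a b_le e by linarith
  then have "2 / 3 * e * (n - real (card W)) \<le> b * n"
    and dense: "(1 - 1 / real r - 2 * b) * (real (card W))\<^sup>2 \<le> real (degree_sum W)"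
    using gains_density_clique_free[OF V W(2) free r gains[unfolded a_def]] e
    by (auto simp: a_def n_def)
  then have "n - real (card W) \<le> 3 * (b * real r ^ 4) * n" using r by (simp add: e_def field_simps)
  then show ?thesis using WV c dense unfolding n_def by blast
qed

lemma ex_subset_high_degree_ambient:
  assumes W: "finite W" and c: "proper_colouring W r c" and r: "r > 0" and \<delta>: "0 < \<delta>"
    and dense: "(1 - 1 / real r - \<delta>\<^sup>2) * (real (card W))\<^sup>2 \<le> real (degree_sum W)"
    and n: "real (card W) \<le> n" "n - real (card W) \<le> \<delta> * n"
  shows "\<exists>U\<subseteq>W. (1 - 2 * \<delta>) * n \<le> real (card U) \<and>
    (\<forall>u\<in>U. (1 - 1 / real r - 4 * \<delta>) * n < real (degree U u))"
proof -
  define m where "m = real (card W)"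
  define a where "a = 1 - 1 / real r"
  obtain U where U: "U \<subseteq> W" "(1 - \<delta>) * m \<le> real (card U)"
    and degree: "\<forall>u\<in>U. (a - 3 * \<delta>) * m < real (degree U u)"
    using ex_subset_high_degree[OF W c r \<delta> dense] unfolding a_def m_def by blast
  have \<delta>m: "\<delta> * m \<le> \<delta> * n" using n(1) \<delta> by (intro mult_left_mono) (auto simp: m_def)
  have "(1 - 2 * \<delta>) * n \<le> (1 - \<delta>) * m" using n \<delta>m by (simp add: m_def left_diff_distrib)
  then have card: "(1 - 2 * \<delta>) * n \<le> real (card U)" using U(2) by linarith
  have "a * (n - m) \<le> 1 * (n - m)" using n r by (intro mult_right_mono) (auto simp: a_def m_def)
  then have "(a - 4 * \<delta>) * n \<le> (a - 3 * \<delta>) * m"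
    using n \<delta>m by (simp add: m_def algebra_simps)
  then have "\<forall>u\<in>U. (a - 4 * \<delta>) * n < real (degree U u)" using degree by force
  then show ?thesis using U(1) card unfolding a_def by blast
qed

theorem spectral_stability:
  fixes b :: real and r :: nat
  assumes V: "finite V" and r: "r \<ge> 2" and b: "0 < b" "b < 1 / (2 ^ 10 * real r ^ 6)"
    and n: "r ^ 20 \<le> card V" and top: "(1 - 1 / real r - b) * real (card V) \<le> top_eigenvalue V"
    and J: "edge_cliques_le V (Suc r) (real (card V) ^ (r - 1) / real r ^ (2 * r + 5))"
  shows "\<exists>U c. U \<subseteq> V \<and> U \<noteq> {} \<and> proper_colouring U r c \<and>
    (1 - 4 * b powr (1 / 3)) * real (card V) \<le> real (card U) \<and>
    (\<forall>u\<in>U. (1 - 1 / real r - 7 * b powr (1 / 3)) * real (card V) < real (degree U u))"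
proof -
  define \<beta> where "\<beta> = b powr (1 / 3)"
  define n where "n = real (card V)"
  note \<beta> = cube_root_bounds[OF r b, folded \<beta>_def]
  have "16 * real r ^ 4 \<le> real r ^ 16 * real r ^ 4"
    using r power_mono[of 2 "real r" 16] by (intro mult_right_mono) auto
  also have "\<dots> = real (r ^ 20)" by (simp flip: power_add)
  also have "\<dots> \<le> real (card V)" using n by (rule of_nat_mono)
  finally have large: "16 * real r ^ 4 \<le> real (card V)" .
  moreover have "0 < 16 * real r ^ 4" using r by simp
  ultimately have n0: "0 < n" unfolding n_def by linarith
  have "b * real r ^ 4 \<le> 1 / 200" using \<beta> by linarith
  then obtain W c where WV: "W \<subseteq> V" and c: "proper_colouring W r c"
    and deleted: "n - real (card W) \<le> 3 * (b * real r ^ 4) * n"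
    and dense: "(1 - 1 / real r - 2 * b) * (real (card W))\<^sup>2 \<le> real (degree_sum W)"
    using ex_dense_multipartite_subset[OF V r less_imp_le[OF b(1)] _ large top J]
    unfolding n_def by blast
  have W: "finite W" "real (card W) \<le> n" using WV V by (auto simp: n_def card_mono finite_subset)
  have "3 * (b * real r ^ 4) * n \<le> \<beta> * n" using \<beta> n0 by (intro mult_right_mono) auto
  then have close: "n - real (card W) \<le> \<beta> * n" using deleted by linarith
  have "2 * \<beta> * \<beta>\<^sup>2 \<le> 1 * \<beta>\<^sup>2" using \<beta> by (intro mult_right_mono) auto
  then have "2 * b \<le> \<beta>\<^sup>2" using \<beta>(2) by (simp add: power3_eq_cube power2_eq_square)
  then have "(1 - 1 / real r - \<beta>\<^sup>2) * (real (card W))\<^sup>2 \<le>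
      (1 - 1 / real r - 2 * b) * (real (card W))\<^sup>2"
    by (intro mult_right_mono) auto
  then obtain U where U: "U \<subseteq> W" "(1 - 2 * \<beta>) * n \<le> real (card U)"
    and degree: "\<forall>u\<in>U. (1 - 1 / real r - 4 * \<beta>) * n < real (degree U u)"
    using ex_subset_high_degree_ambient[OF W(1) c _ \<beta>(1) _ W(2) close] dense r by auto
  have pos: "0 < \<beta> * n" "0 < (1 - 4 * \<beta>) * n" using \<beta>(1,3) n0 by auto
  then have card: "(1 - 4 * \<beta>) * n \<le> real (card U)" using U(2) by (simp add: left_diff_distrib)
  then have "U \<noteq> {}" using pos(2) by auto
  moreover have "(1 - 1 / real r - 7 * \<beta>) * n < (1 - 1 / real r - 4 * \<beta>) * n"
    using pos(1) by (simp add: left_diff_distrib)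
  then have "\<forall>u\<in>U. (1 - 1 / real r - 7 * \<beta>) * n < real (degree U u)" using degree by force
  moreover have "proper_colouring U r c" using c U(1) by (auto simp: proper_colouring_def)
  ultimately show ?thesis using U(1) WV card unfolding \<beta>_def n_def by blast
qed

lemma eigenvalue_le_top:
  assumes V: "finite V" and x: "\<And>u. u \<in> V \<Longrightarrow> (\<Sum>v\<in>nbrs V u. x v) = k * x u"
    and nonzero: "\<exists>u\<in>V. x u \<noteq> 0"
  shows "k \<le> top_eigenvalue V"
proof -
  have "k * sq_norm V x = adj_form V x"
    unfolding adj_form_alt sq_norm_def sum_distrib_left[of k]
    by (intro sum.cong refl) (simp add: x power2_eq_square)
  also have "\<dots> \<le> top_eigenvalue V * sq_norm V x" by (rule adj_form_le_top[OF V])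
  finally have "k * sq_norm V x \<le> top_eigenvalue V * sq_norm V x" .
  moreover obtain u where "u \<in> V" "x u \<noteq> 0" using nonzero by blast
  then have "0 < sq_norm V x" using V unfolding sq_norm_def by (intro sum_pos2[of _ u]) auto
  ultimately show ?thesis by simp
qed

end

section \<open>Graphs as symmetric digraphs\<close>

context graph begin

sublocale adj: simple_adjacency "\<lambda>u v. (u, v) \<in> arcs_ends G"
proof
  show "(v, u) \<in> arcs_ends G" if "(u, v) \<in> arcs_ends G" for u v
    using that by (rule graph_symmetric)
  show "(u, u) \<notin> arcs_ends G" for u using adj_not_same by blast
qed

definition adjacency_matrix_of :: "'a list \<Rightarrow> real mat" where
  "adjacency_matrix_of vs =
     mat (length vs) (length vs) (\<lambda>(i, j). if (vs ! i, vs ! j) \<in> arcs_ends G then 1 else 0)"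

lemma obtain_adjacency_matrix_of:
  obtains vs where "distinct vs" "set vs = verts G" "adjacency_matrix G = adjacency_matrix_of vs"
proof
  define vs where "vs = (SOME vs. distinct vs \<and> set vs = verts G)"
  have "\<exists>vs. distinct vs \<and> set vs = verts G" using finite_distinct_list[of "verts G"] by auto
  then show "distinct vs" "set vs = verts G"
    unfolding vs_def by (metis (mono_tags, lifting) someI_ex)+
  show "adjacency_matrix G = adjacency_matrix_of vs"
    by (simp add: adjacency_matrix_def adjacency_matrix_of_def vs_def Let_def)
qed

lemma adjacency_matrix_carrier: "adjacency_matrix G \<in> carrier_mat (card (verts G)) (card (verts G))"
proof -
  obtain vs where "distinct vs" "set vs = verts G" "adjacency_matrix G = adjacency_matrix_of vs"
    by (rule obtain_adjacency_matrix_of)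
  then show ?thesis using distinct_card[of vs] by (simp add: adjacency_matrix_of_def)
qed

lemma adjacency_matrix_of_mult_vec:
  assumes vs: "distinct vs" "set vs = verts G"
  shows "adjacency_matrix_of vs *\<^sub>v vec (length vs) (\<lambda>i. x (vs ! i)) =
    vec (length vs) (\<lambda>i. \<Sum>v\<in>adj.nbrs (verts G) (vs ! i). x v)"
    (is "_ = ?w")
proof (rule eq_vecI)
  fix i assume "i < dim_vec ?w"
  then have i: "i < length vs" by simp
  have nth: "bij_betw ((!) vs) {..<length vs} (verts G)" using vs by (intro bij_betw_nth) auto
  have "(\<Sum>j<length vs. (if (vs ! i, vs ! j) \<in> arcs_ends G then 1 else 0) * x (vs ! j)) =
      (\<Sum>v\<in>verts G. (if (vs ! i, v) \<in> arcs_ends G then 1 else 0) * x v)"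
    by (rule sum.reindex_bij_betw[OF nth])
  also have "\<dots> = (\<Sum>v\<in>verts G. if (vs ! i, v) \<in> arcs_ends G then x v else 0)"
    by (intro sum.cong) auto
  also have "\<dots> = (\<Sum>v\<in>adj.nbrs (verts G) (vs ! i). x v)"
    unfolding adj.nbrs_def by (rule sum.inter_filter[symmetric]) simp
  finally show "(adjacency_matrix_of vs *\<^sub>v vec (length vs) (\<lambda>i. x (vs ! i))) $ i = ?w $ i"
    using i by (simp add: adjacency_matrix_of_def scalar_prod_def atLeast0LessThan)
qed (simp add: adjacency_matrix_of_def)

lemma spectrum_adjacency_matrix:
  "k \<in> spectrum (adjacency_matrix G) \<longleftrightarrow>
    (\<exists>x. (\<exists>u\<in>verts G. x u \<noteq> 0) \<and> (\<forall>u\<in>verts G. (\<Sum>v\<in>adj.nbrs (verts G) u. x v) = k * x u))"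
    (is "_ \<longleftrightarrow> (\<exists>x. ?eigen x)")
proof -
  obtain vs where vs: "distinct vs" "set vs = verts G"
    and A: "adjacency_matrix G = adjacency_matrix_of vs"
    by (rule obtain_adjacency_matrix_of)
  let ?n = "length vs"
  let ?vec = "\<lambda>x. vec ?n (\<lambda>i. x (vs ! i))"
  have all_nth: "(\<forall>u\<in>verts G. P u) \<longleftrightarrow> (\<forall>i<?n. P (vs ! i))" for P
    using all_set_conv_all_nth[of vs P] vs(2) by simp
  have eigenvector: "eigenvector (adjacency_matrix G) (?vec x) k \<longleftrightarrow> ?eigen x" for x
  proof -
    have "?vec x \<noteq> 0\<^sub>v ?n \<longleftrightarrow> (\<exists>u\<in>verts G. x u \<noteq> 0)"
      using all_nth[of "\<lambda>u. x u = 0"] by (auto simp: vec_eq_iff)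
    moreover have "adjacency_matrix G *\<^sub>v ?vec x = k \<cdot>\<^sub>v ?vec x \<longleftrightarrow>
        (\<forall>u\<in>verts G. (\<Sum>v\<in>adj.nbrs (verts G) u. x v) = k * x u)"
      unfolding A adjacency_matrix_of_mult_vec[OF vs] all_nth by (auto simp: vec_eq_iff)
    ultimately show ?thesis by (simp add: eigenvector_def A adjacency_matrix_of_def)
  qed
  define coords where "coords v u = v $ inv_into {..<?n} ((!) vs) u" for v :: "real vec" and u
  have vec_coords: "v = ?vec (coords v)" if "eigenvector (adjacency_matrix G) v k" for v
  proof -
    have "inj_on ((!) vs) {..<?n}" using vs(1) by (simp add: inj_on_nth)
    then show ?thesis
      using that
      by (intro eq_vecI) (auto simp: eigenvector_def A adjacency_matrix_of_def coords_def)
  qed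
  show ?thesis
    unfolding spectrum_def eigenvalue_def mem_Collect_eq
  proof
    assume "\<exists>v. eigenvector (adjacency_matrix G) v k"
    then obtain v where v: "eigenvector (adjacency_matrix G) v k" ..
    then have "eigenvector (adjacency_matrix G) (?vec (coords v)) k"
      by (subst (asm) vec_coords[OF v])
    from iffD1[OF eigenvector this] show "\<exists>x. ?eigen x" by (rule exI[of _ "coords v"])
  next
    assume "\<exists>x. ?eigen x"
    then obtain x where "?eigen x" ..
    from iffD2[OF eigenvector this] show "\<exists>v. eigenvector (adjacency_matrix G) v k" by (rule exI)
  qed
qed

theorem graph_index_eq_top_eigenvalue:
  assumes "verts G \<noteq> {}"
  shows "graph_index G = adj.top_eigenvalue (verts G)"
  unfolding graph_index_def
proof (rule Max_eqI)
  show "finite (spectrum (adjacency_matrix G))"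
    by (rule card_finite_spectrum(1)[OF adjacency_matrix_carrier])
  show "k \<le> adj.top_eigenvalue (verts G)" if "k \<in> spectrum (adjacency_matrix G)" for k
    using that adj.eigenvalue_le_top[OF finite_verts] unfolding spectrum_adjacency_matrix by blast
  obtain x where x: "adj.perron (verts G) x" using adj.ex_perron[OF finite_verts assms] by blast
  have "\<exists>u\<in>verts G. x u \<noteq> 0"
    using x by (auto simp: adj.perron_def adj.sq_norm_def intro: ccontr)
  then show "adj.top_eigenvalue (verts G) \<in> spectrum (adjacency_matrix G)"
    using adj.perron_eigenvector[OF finite_verts x] unfolding spectrum_adjacency_matrix by blast
qed

lemma arcs_ends_induce:
  "arcs_ends (G \<restriction> R) = {(u, v) \<in> arcs_ends G. u \<in> R \<and> v \<in> R}"
  by (auto simp: arcs_ends_conv)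

lemma graph_of_symmetric_subgraph:
  assumes "subgraph H G" "symmetric H"
  shows "graph H"
  using digraph.graphI[OF digraph_subgraph[OF assms(1)] assms(2)] .

lemma complete_induce_clique:
  assumes "R \<in> adj.cliques (verts G) k"
  shows "complete_digraph k (G \<restriction> R)"
proof -
  have R: "R \<subseteq> verts G" using assms by (simp add: adj.cliques_def)
  have "symmetric (G \<restriction> R)"
    using induced_graph_imp_symmetric[OF sym_arcs induced_induce[OF R]] .
  then have "graph (G \<restriction> R)"
    by (rule graph_of_symmetric_subgraph[OF subgraph_induce_subgraphI[OF R]])
  then show ?thesis
    using assms adj.irrefl
    by (auto simp: complete_digraph_def adj.cliques_def arcs_ends_induce pairwise_def)
qed

lemma subgraph_Union_induce:
  assumes "\<And>R. R \<in> \<R> \<Longrightarrow> R \<subseteq> verts G"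
  shows "subgraph (Union ((\<restriction>) G ` \<R>)) G"
proof (rule subgraphI)
  show "wf_digraph (Union ((\<restriction>) G ` \<R>))" by unfold_locales (auto simp: Union_def)
qed (use assms wf_digraph in \<open>auto simp: Union_def compatible_def\<close>)

lemma is_joint_Union_induce:
  assumes \<R>: "\<R> \<subseteq> adj.cliques (verts G) k" and uv: "(u, v) \<in> arcs_ends G" "\<And>R. R \<in> \<R> \<Longrightarrow> {u, v} \<subseteq> R"
  shows "is_joint k (card \<R>) (Union ((\<restriction>) G ` \<R>))"
proof -
  define J where "J = Union ((\<restriction>) G ` \<R>)"
  have sub: "R \<subseteq> verts G" if "R \<in> \<R>" for R using \<R> that by (auto simp: adj.cliques_def)
  have "subgraph J G" unfolding J_def by (rule subgraph_Union_induce[OF sub])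
  moreover have "arcs_ends J = (\<Union>R\<in>\<R>. arcs_ends (G \<restriction> R))"
    by (auto simp: J_def Union_def arcs_ends_conv)
  then have "symmetric J"
    using adj.sym by (auto simp: symmetric_def sym_def arcs_ends_induce)
  ultimately have J: "graph J" by (rule graph_of_symmetric_subgraph)
  obtain e where e: "e \<in> arcs G" "tail G e = u" "head G e = v" using uv(1) by (rule reachableE)
  have "inj_on ((\<restriction>) G) \<R>" by (rule inj_on_inverseI[where g = verts]) simp
  moreover have "finite \<R>" using \<R> by (rule finite_subset) simp
  moreover have "subgraph (G \<restriction> R) J" if "R \<in> \<R>" for R
    using that J
    by (intro subgraphI)
       (auto simp: J_def Union_def compatible_def graph_def digraph_def fin_digraph_def)
  ultimately show ?thesis
    unfolding is_joint_def J_def[symmetric]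
    using J \<R> complete_induce_clique e uv(2)
    by (intro conjI exI[of _ "(\<restriction>) G ` \<R>"] exI[of _ e]) (auto simp: card_image J_def Union_def)
qed

lemma finite_subgraphs: "finite {H. subgraph H G}"
proof (rule finite_subset)
  let ?record = "\<lambda>(V, A). \<lparr>verts = V, arcs = A, tail = tail G, head = head G\<rparr>"
  show "{H. subgraph H G} \<subseteq> ?record ` (Pow (verts G) \<times> Pow (arcs G))"
  proof
    fix H assume "H \<in> {H. subgraph H G}"
    then show "H \<in> ?record ` (Pow (verts G) \<times> Pow (arcs G))"
      by (intro image_eqI[of _ _ "(verts H, arcs H)"]) (auto simp: subgraph_def compatible_def)
  qed
qed simp

lemma joint_size_ge:
  assumes "subgraph J G" "is_joint k t J"
  shows "t \<le> joint_size k G"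
  unfolding joint_size_def
proof (rule Max_ge)
  have "t \<le> card {H. subgraph H G}" if J: "subgraph J G" "is_joint k t J" for t J
  proof -
    obtain C where C: "card C = t" "\<forall>H\<in>C. subgraph H J \<and> complete_digraph k H"
      using J(2) unfolding is_joint_def by (elim conjE exE)
    then have "C \<subseteq> {H. subgraph H G}" using subgraph_trans[OF _ J(1)] by auto
    then show ?thesis using card_mono[OF finite_subgraphs] C(1) by blast
  qed
  then have "{t. \<exists>J. subgraph J G \<and> is_joint k t J} \<subseteq> {..card {H. subgraph H G}}" by auto
  then show "finite {t. \<exists>J. subgraph J G \<and> is_joint k t J}" by (rule finite_subset) simp
  show "t \<in> {t. \<exists>J. subgraph J G \<and> is_joint k t J}" using assms by blast
qed

lemma edge_cliques_le_joint_size: "adj.edge_cliques_le (verts G) k (real (joint_size k G))"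
  unfolding adj.edge_cliques_le_def
proof
  fix T assume T: "T \<in> adj.cliques (verts G) 2"
  let ?\<R> = "adj.clique_extensions (verts G) k T"
  from T obtain u v where uv: "T = {u, v}" "u \<noteq> v" by (auto simp: adj.cliques_def card_2_iff)
  then have "(u, v) \<in> arcs_ends G" using T by (simp add: adj.doubleton_cliques)
  then have "is_joint k (card ?\<R>) (Union ((\<restriction>) G ` ?\<R>))"
    using uv(1) by (intro is_joint_Union_induce) (auto simp: adj.clique_extensions_def)
  moreover have "subgraph (Union ((\<restriction>) G ` ?\<R>)) G"
    by (rule subgraph_Union_induce) (auto simp: adj.clique_extensions_def adj.cliques_def)
  ultimately show "real (card ?\<R>) \<le> real (joint_size k G)"
    using joint_size_ge by simp
qed

lemma multipartite_induce:
  assumes "adj.proper_colouring U r c"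
  shows "multipartite r (G \<restriction> U)"
  unfolding multipartite_def
proof (intro exI[of _ "\<lambda>i. {u \<in> U. c u = i}"] conjI allI impI)
  show "disjoint_family_on (\<lambda>i. {u \<in> U. c u = i}) {..<r}" by (auto simp: disjoint_family_on_def)
  show "(\<Union>i<r. {u \<in> U. c u = i}) = verts (G \<restriction> U)"
    using assms by (auto simp: adj.proper_colouring_def)
  show "independent_in (G \<restriction> U) {u \<in> U. c u = i}" for i
    using assms by (fastforce simp: independent_in_def arcs_ends_induce adj.proper_colouring_def)
qed

lemma out_degree_induce:
  assumes "u \<in> U" "U \<subseteq> verts G"
  shows "out_degree (G \<restriction> U) u = adj.degree U u"
proof -
  have "bij_betw (head G) (out_arcs (G \<restriction> U) u) (adj.nbrs U u)"
  proof (rule bij_betw_imageI)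
    show "inj_on (head G) (out_arcs (G \<restriction> U) u)"
      by (rule inj_onI) (auto intro: no_multi_arcs simp: arc_to_ends_def)
    show "head G ` out_arcs (G \<restriction> U) u = adj.nbrs U u"
      unfolding adj.nbrs_def using assms by (force simp: arcs_ends_conv)
  qed
  then show ?thesis by (simp add: out_degree_def adj.degree_def bij_betw_same_card)
qed

lemma less_min_degree_induce:
  assumes "U \<subseteq> verts G" "U \<noteq> {}" "\<And>u. u \<in> U \<Longrightarrow> d < real (adj.degree U u)"
  shows "d < real (min_degree (G \<restriction> U))"
proof -
  have "finite U" using assms(1) by (rule finite_subset) simp
  then have "min_degree (G \<restriction> U) \<in> out_degree (G \<restriction> U) ` U"
    unfolding min_degree_def using assms(2) by (simp add: Min_in)
  then show ?thesis using assms out_degree_induce by auto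
qed

end

theorem theorem4:
  fixes r n :: nat and b :: real and G :: "('a, 'b) pre_digraph"
  assumes "r \<ge> 2"
    and "0 < b" and "b < 1 / (2 ^ 10 * real r ^ 6)"
    and "n \<ge> r ^ 20"
    and "graph G" and "card (verts G) = n"
    and "graph_index G > (1 - 1 / real r - b) * real n"
  shows "real (joint_size (r + 1) G) > real n ^ (r - 1) / real r ^ (2 * r + 5) \<or>
    (\<exists>G0. induced_subgraph G0 G \<and> multipartite r G0 \<and>
       real (card (verts G0)) \<ge> (1 - 4 * b powr (1 / 3)) * real n \<and>
       real (min_degree G0) > (1 - 1 / real r - 7 * b powr (1 / 3)) * real n)"
proof (cases "real (joint_size (r + 1) G) > real n ^ (r - 1) / real r ^ (2 * r + 5)")
  case False
  interpret graph G by fact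
  have "0 < r ^ 20" using assms(1) by simp
  then have "verts G \<noteq> {}" using assms(4,6) by auto
  then have top: "(1 - 1 / real r - b) * real (card (verts G)) \<le> adj.top_eigenvalue (verts G)"
    using assms(6,7) by (simp add: graph_index_eq_top_eigenvalue)
  have "adj.edge_cliques_le (verts G) (Suc r)
      (real (card (verts G)) ^ (r - 1) / real r ^ (2 * r + 5))"
    using adj.edge_cliques_le_mono[OF finite_verts order_refl edge_cliques_le_joint_size]
      False assms(6) by simp
  then obtain U c where U: "U \<subseteq> verts G" "U \<noteq> {}" "adj.proper_colouring U r c"
      "(1 - 4 * b powr (1 / 3)) * real n \<le> real (card U)"
      "\<forall>u\<in>U. (1 - 1 / real r - 7 * b powr (1 / 3)) * real n < real (adj.degree U u)"
    using adj.spectral_stability[OF finite_verts assms(1-3) _ top] assms(4,6) by blast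
  then have "induced_subgraph (G \<restriction> U) G" "multipartite r (G \<restriction> U)"
    "(1 - 1 / real r - 7 * b powr (1 / 3)) * real n < real (min_degree (G \<restriction> U))"
    using induced_induce multipartite_induce less_min_degree_induce by auto
  then show ?thesis using U(4) by (intro disjI2 exI[of _ "G \<restriction> U"]) simp
qed simp

end
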